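(* Let $\rho_{ABC}$ be a positive definite density operator on $\mathcal{H}_{ABC}$. Then $\lim_{\alpha\to1}I_\alpha(A;B|C)_\rho=I(A;B|C)_\rho$.
   Context: Finite-dimensional Hilbert spaces; natural log; operator powers via spectral calculus (negative powers on the support); operators on subsystems tensored with identities; subscripts denote marginals. $I(A;B|C)_\rho=H(AC)+H(BC)-H(C)-H(ABC)$ (von Neumann entropies). For $\alpha\in[0,1)\cup(1,\infty)$, $I_\alpha(A;B|C)_\rho\equiv\inf_{\sigma_{BC}}\frac{1}{\alpha-1}\log\operatorname{Tr}\{\rho_{ABC}^{\alpha}\rho_{AC}^{(1-\alpha)/2}\rho_C^{(\alpha-1)/2}\sigma_{BC}^{1-\alpha}\rho_C^{(\alpha-1)/2}\rho_{AC}^{(1-\alpha)/2}\}$, the infimum over density operators $\sigma_{BC}$ with $\operatorname{supp}(\rho_{ABC})\subseteq\operatorname{supp}(I_A\otimes\sigma_{BC})$. *)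

theory Defs
  imports "HOL-Analysis.Analysis"
begin

text \<open>Operators on a finite-dimensional Hilbert space with orthonormal basis
  indexed by a finite type 'n are represented as matrices complex^'n^'n.
  Composite systems use product index types: H_ABC has basis 'a \<times> 'b \<times> 'c.\<close>

type_synonym 'n op = "complex^'n^'n"

definition cadj :: "'n::finite op \<Rightarrow> 'n op" where
  "cadj M = (\<chi> i j. cnj (M $ j $ i))"

definition unitary :: "'n::finite op \<Rightarrow> bool" where
  "unitary U \<longleftrightarrow> U ** cadj U = mat 1 \<and> cadj U ** U = mat 1"

definition diagm :: "('n::finite \<Rightarrow> complex) \<Rightarrow> 'n op" where
  "diagm d = (\<chi> i j. if i = j then d i else 0)"

definition qform :: "'n::finite op \<Rightarrow> complex^'n \<Rightarrow> complex" where
  "qform M x = (\<Sum>i\<in>UNIV. \<Sum>j\<in>UNIV. cnj (x $ i) * M $ i $ j * x $ j)"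

definition psd :: "'n::finite op \<Rightarrow> bool" where
  "psd M \<longleftrightarrow> (\<forall>x. Im (qform M x) = 0 \<and> Re (qform M x) \<ge> 0)"

definition posdef :: "'n::finite op \<Rightarrow> bool" where
  "posdef M \<longleftrightarrow> (\<forall>x. Im (qform M x) = 0 \<and> (x \<noteq> 0 \<longrightarrow> Re (qform M x) > 0))"

definition density_op :: "'n::finite op \<Rightarrow> bool" where
  "density_op M \<longleftrightarrow> psd M \<and> trace M = 1"

text \<open>Support (= range, for Hermitian operators).\<close>
definition supp :: "'n::finite op \<Rightarrow> (complex^'n) set" where
  "supp M = range (\<lambda>x. M *v x)"

text \<open>Spectral calculus for Hermitian operators: f(M) = U diag(f \<lambda>) U*, where
  M = U diag(\<lambda>) U* with U unitary and \<lambda> real (the result does not depend on the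
  chosen decomposition).\<close>
definition mfun :: "(real \<Rightarrow> real) \<Rightarrow> 'n::finite op \<Rightarrow> 'n op" where
  "mfun f M = (SOME N. \<exists>U (l :: 'n \<Rightarrow> real). unitary U \<and>
      M = U ** diagm (\<lambda>i. complex_of_real (l i)) ** cadj U \<and>
      N = U ** diagm (\<lambda>i. complex_of_real (f (l i))) ** cadj U)"

text \<open>Real powers; negative (and zero) powers are taken on the support.\<close>
definition mpow :: "'n::finite op \<Rightarrow> real \<Rightarrow> 'n op" where
  "mpow M s = mfun (\<lambda>x. if x > 0 then x powr s else 0) M"

definition vN :: "'n::finite op \<Rightarrow> real" where
  "vN M = - Re (trace (M ** mfun (\<lambda>x. if x > 0 then ln x else 0) M))"

definition marg_AC :: "('a::finite \<times> 'b::finite \<times> 'c::finite) op \<Rightarrow> ('a \<times> 'c) op" where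
  "marg_AC M = (\<chi> i j. \<Sum>b\<in>UNIV. M $ (fst i, b, snd i) $ (fst j, b, snd j))"

definition marg_BC :: "('a::finite \<times> 'b::finite \<times> 'c::finite) op \<Rightarrow> ('b \<times> 'c) op" where
  "marg_BC M = (\<chi> i j. \<Sum>a\<in>UNIV. M $ (a, i) $ (a, j))"

definition marg_C :: "('a::finite \<times> 'b::finite \<times> 'c::finite) op \<Rightarrow> 'c op" where
  "marg_C M = (\<chi> i j. \<Sum>a\<in>UNIV. \<Sum>b\<in>UNIV. M $ (a, b, i) $ (a, b, j))"

text \<open>Operators on subsystems tensored with identities, as operators on ABC.\<close>
definition ext_AC :: "('a::finite \<times> 'c::finite) op \<Rightarrow> ('a \<times> 'b::finite \<times> 'c) op" where
  "ext_AC X = (\<chi> i j. if fst (snd i) = fst (snd j)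
      then X $ (fst i, snd (snd i)) $ (fst j, snd (snd j)) else 0)"

definition ext_BC :: "('b::finite \<times> 'c::finite) op \<Rightarrow> ('a::finite \<times> 'b \<times> 'c) op" where
  "ext_BC X = (\<chi> i j. if fst i = fst j then X $ snd i $ snd j else 0)"

definition ext_C :: "'c::finite op \<Rightarrow> ('a::finite \<times> 'b::finite \<times> 'c) op" where
  "ext_C X = (\<chi> i j. if fst i = fst j \<and> fst (snd i) = fst (snd j)
      then X $ snd (snd i) $ snd (snd j) else 0)"

definition cmi :: "('a::finite \<times> 'b::finite \<times> 'c::finite) op \<Rightarrow> real" where
  "cmi \<rho> = vN (marg_AC \<rho>) + vN (marg_BC \<rho>) - vN (marg_C \<rho>) - vN \<rho>"

definition renyi_cmi :: "real \<Rightarrow> ('a::finite \<times> 'b::finite \<times> 'c::finite) op \<Rightarrow> real" where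
  "renyi_cmi \<alpha> \<rho> =
    (INF \<sigma> \<in> {\<sigma> :: ('b \<times> 'c) op. density_op \<sigma> \<and>
                 supp \<rho> \<subseteq> supp (ext_BC \<sigma> :: ('a \<times> 'b \<times> 'c) op)}.
       1 / (\<alpha> - 1) * ln (Re (trace (
          mpow \<rho> \<alpha>
          ** ext_AC (mpow (marg_AC \<rho>) ((1 - \<alpha>) / 2))
          ** ext_C (mpow (marg_C \<rho>) ((\<alpha> - 1) / 2))
          ** (ext_BC (mpow \<sigma> (1 - \<alpha>)) :: ('a \<times> 'b \<times> 'c) op)
          ** ext_C (mpow (marg_C \<rho>) ((\<alpha> - 1) / 2))
          ** ext_AC (mpow (marg_AC \<rho>) ((1 - \<alpha>) / 2))))))"

end

(* The trace in the definition equals Tr(X_a s^(1-a)), where X_a is the marginal on BC of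
   C^(1/2) A^(1/2) rho^a A^(1/2) C^(1/2) with A = rho_AC^(1-a), C = rho_C^(a-1), and X_1 = rho_BC.
   Taking s = rho_BC gives an upper bound of the form ln F(a) / (a-1) with F(1) = 1, whose limit is
   F'(1) = I(A;B|C).  For a lower bound valid for every s, Young's inequality
   x s^(1-a) <= a x^(1/a) + (1-a) s  (reversed for a > 1) is summed against the doubly stochastic matrix
   |<u_i,v_j>|^2 of the two eigenbases, which gives Tr(X_a s^(1-a)) <= a Tr X_a^(1/a) + 1 - a
   (reversed for a > 1).  A second
   use of it compares Tr X_a^(1/a) with Tr X_1^(1/a), so the bound does not depend on s, and it has the same
   derivative F'(1) at a = 1. *)
theory Submission
  imports Defs
begin

text \<open>The obstacle is the interchange of limit and infimum. Every fixed \<sigma> has its own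
  limit at \<alpha> = 1, but \<sigma> may approach the boundary of the state space, where its
  logarithm is unbounded, so convergence cannot be expected to be uniform in \<sigma>. The first
  Young bound removes \<sigma> but leaves Tr X_a^(1/a), in which base and exponent move together
  while X_a need not commute with X_1. The second one freezes the base. Its price is the correction
  Tr((X_a - X_1) X_a^(1/a-1)), which differs from Tr(X_a - X_1) by a product of two factors that
  both vanish at a = 1 and so adds no slope. The only derivatives taken are those of powers of fixed
  operators, with X_a itself entering linearly. Inequalities carry the factor 1 - a in front of a
  difference, so that one statement covers both sides of a = 1.\<close>

section \<open>Spectral theorem and functional calculus\<close>

text \<open>A maximiser \<open>x\<close> of the Rayleigh quotient on the unit sphere of
  \<open>W\<close> is an eigenvector: moving it by \<open>t\<close> times the residual
  \<open>f x - l *\<^sub>R x\<close> would otherwise raise the quotient to first order in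
  \<open>t\<close>. The setting is real because the Hermitian inner product enters later through its
  real part.\<close>

lemma selfadjoint_eigenvector:
  fixes f :: "'v::euclidean_space \<Rightarrow> 'v"
  assumes f: "linear f" and W: "subspace W" and inv: "\<And>x. x \<in> W \<Longrightarrow> f x \<in> W"
    and sa: "\<And>x y. f x \<bullet> y = x \<bullet> f y" and z: "z \<in> W" "z \<noteq> 0"
  obtains x l where "x \<in> W" "norm x = 1" "f x = l *\<^sub>R x"
proof -
  interpret linear f by (rule f)
  let ?S = "W \<inter> sphere 0 1"
  have "compact ?S"
    using closed_subspace[OF W] compact_sphere by (metis closed_Int_compact)
  moreover have "(1 / norm z) *\<^sub>R z \<in> ?S"
    using z W by (auto simp: subspace_scale)
  moreover have "continuous_on ?S (\<lambda>x. x \<bullet> f x)"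
    by (intro continuous_intros linear_continuous_on) (simp add: f linear_conv_bounded_linear[symmetric])
  ultimately obtain x where x: "x \<in> ?S" and mx: "\<And>y. y \<in> ?S \<Longrightarrow> y \<bullet> f y \<le> x \<bullet> f x"
    using continuous_attains_sup[of ?S "\<lambda>x. x \<bullet> f x"] by blast
  define l where "l = x \<bullet> f x"
  have bound: "y \<bullet> f y \<le> l * (y \<bullet> y)" if "y \<in> W" for y
  proof (cases "y = 0")
    case True then show ?thesis by (simp add: zero)
  next
    case False
    have "(1 / norm y) *\<^sub>R y \<in> ?S" using that False W by (auto simp: subspace_scale)
    from mx[OF this] have "(y \<bullet> f y) / (norm y)\<^sup>2 \<le> l"
      by (simp add: l_def scale power2_eq_square)
    with False have "(y \<bullet> f y) \<le> l * (norm y)\<^sup>2" by (simp add: divide_le_eq)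
    then show ?thesis by (simp add: power2_norm_eq_inner)
  qed
  define y where "y = f x - l *\<^sub>R x"
  have xW: "x \<in> W" and xx: "x \<bullet> x = 1" using x by (auto simp: norm_eq_1)
  have yW: "y \<in> W" unfolding y_def using xW W inv by (simp add: subspace_diff subspace_scale)
  define k where "k = l * (y \<bullet> y) - y \<bullet> f y"
  have quad: "2 * t * (y \<bullet> y) \<le> t\<^sup>2 * k" for t
  proof -
    have "x + t *\<^sub>R y \<in> W" using xW yW W by (simp add: subspace_add subspace_scale)
    from bound[OF this]
    have "l + 2 * t * (y \<bullet> f x) + t\<^sup>2 * (y \<bullet> f y) \<le> l * (1 + 2 * t * (y \<bullet> x) + t\<^sup>2 * (y \<bullet> y))"
      using sa[of x y]
      by (simp add: add scale inner_add_left inner_add_right xx l_def[symmetric] inner_commute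
          power2_eq_square algebra_simps)
    moreover have "2 * t * (y \<bullet> y) = 2 * t * (y \<bullet> f x) - l * (2 * t * (y \<bullet> x))"
      by (subst (2) y_def) (simp add: inner_diff_right algebra_simps)
    moreover have "t\<^sup>2 * k = l * (t\<^sup>2 * (y \<bullet> y)) - t\<^sup>2 * (y \<bullet> f y)"
      by (simp add: k_def algebra_simps)
    ultimately show ?thesis by (simp add: distrib_left)
  qed
  have "y \<bullet> y \<le> 0"
  proof (rule ccontr)
    assume "\<not> y \<bullet> y \<le> 0"
    then have p: "y \<bullet> y > 0" by linarith
    \<comment> \<open>The denominator makes \<open>t * k\<close> at most
      \<open>y \<bullet> y\<close>, against \<open>2 * (y \<bullet> y) \<le> t * k\<close>; the
      added 1 keeps it positive when \<open>k = 0\<close>.\<close>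
    define t where "t = (y \<bullet> y) / (\<bar>k\<bar> + 1)"
    have t: "t > 0" unfolding t_def using p by (intro divide_pos_pos) auto
    have "t * (2 * (y \<bullet> y)) \<le> t * (t * k)" using quad[of t] by (simp add: power2_eq_square algebra_simps)
    then have "2 * (y \<bullet> y) \<le> t * k" using t by simp
    also have "\<dots> \<le> t * (\<bar>k\<bar> + 1)" using t by (intro mult_left_mono) auto
    also have "\<dots> = y \<bullet> y" unfolding t_def by simp
    finally show False using p by simp
  qed
  then have "y = 0" by (metis inner_gt_zero_iff not_le)
  then have "f x = l *\<^sub>R x" by (simp add: y_def)
  with that xW x show thesis by auto
qed

definition cinn :: "complex^'n::finite \<Rightarrow> complex^'n \<Rightarrow> complex" where
  "cinn x y = (\<Sum>i\<in>UNIV. cnj (x $ i) * y $ i)"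

lemma Re_cinn: "Re (cinn x y) = x \<bullet> y"
  by (simp add: cinn_def inner_vec_def inner_complex_def)

lemma cinn_self: "cinn x x = complex_of_real ((norm x)\<^sup>2)"
proof -
  have "cnj (x $ i) * x $ i = complex_of_real ((cmod (x $ i))\<^sup>2)" for i
    by (simp only: complex_norm_square mult.commute)
  then show ?thesis
    by (simp add: cinn_def norm_vec_def L2_set_def sum_nonneg)
qed

lemma cnj_cinn: "cnj (cinn x y) = cinn y x"
  by (simp add: cinn_def mult.commute)

lemma cinn_adjoint: "cinn (M *v x) y = cinn x (cadj M *v y)"
proof -
  have "cinn (M *v x) y = (\<Sum>i\<in>UNIV. \<Sum>j\<in>UNIV. cnj (M $ i $ j) * cnj (x $ j) * y $ i)"
    by (simp add: cinn_def matrix_vector_mult_def sum_distrib_right)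
  also have "\<dots> = (\<Sum>j\<in>UNIV. \<Sum>i\<in>UNIV. cnj (M $ i $ j) * cnj (x $ j) * y $ i)"
    by (rule sum.swap)
  also have "\<dots> = cinn x (cadj M *v y)"
    by (simp add: cinn_def matrix_vector_mult_def cadj_def sum_distrib_left mult_ac)
  finally show ?thesis .
qed

lemma qform_cinn: "qform M x = cinn x (M *v x)"
  by (simp add: qform_def cinn_def matrix_vector_mult_def sum_distrib_left mult_ac)

lemma cinn_linear:
  "cinn x (y + z) = cinn x y + cinn x z" "cinn x (r *\<^sub>R y) = of_real r * cinn x y" "cinn x 0 = 0"
  "cinn x (a *s y) = a * cinn x y"
  by (auto simp: cinn_def sum.distrib algebra_simps sum_distrib_left scaleR_conv_of_real[where 'a=complex])

lemma matrix_vector_linear: "linear (\<lambda>x. (M :: 'n::finite op) *v x)"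
  by (rule linearI) (simp_all add: vec_eq_iff matrix_vector_mult_def sum.distrib algebra_simps sum_distrib_left scaleR_sum_right)

text \<open>Eigenvectors are added one index at a time. The orthogonal complement of those already
  found is invariant under \<open>M\<close>, because \<open>M\<close> is Hermitian and they are
  eigenvectors.\<close>

lemma orthonormal_eigenvectors:
  fixes M :: "'n::finite op"
  assumes h: "cadj M = M"
  shows "\<exists>v (l :: 'n \<Rightarrow> real). (\<forall>i\<in>I. \<forall>j\<in>I. cinn (v i) (v j) = (if i = j then 1 else 0)) \<and>
            (\<forall>i\<in>I. M *v v i = l i *\<^sub>R v i)"
  using finite[of I]
proof (induction I rule: finite_induct)
  case empty
  show ?case by simp
next
  case (insert k I)
  then obtain v and l :: "'n \<Rightarrow> real" where
    on: "\<And>i j. i \<in> I \<Longrightarrow> j \<in> I \<Longrightarrow> cinn (v i) (v j) = (if i = j then 1 else 0)"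
    and ev: "\<And>i. i \<in> I \<Longrightarrow> M *v v i = l i *\<^sub>R v i" by blast
  define W where "W = {x. \<forall>i\<in>I. cinn (v i) x = 0}"
  \<comment> \<open>Replaces a dimension count: row \<open>k\<close> vanishes, so \<open>A\<close>
    is singular, and a nonzero kernel vector is orthogonal to all vectors found so far.\<close>
  define A :: "'n op" where "A = (\<chi> i. if i \<in> I then \<chi> j. cnj (v i $ j) else 0)"
  have "row k A = 0" using insert.hyps by (simp add: row_def A_def vec_eq_iff)
  then have "det A = 0" using det_zero_row(1) by blast
  then have "\<not> (\<exists>B. B ** A = mat 1)"
    using invertible_det_nz invertible_left_inverse by blast
  then obtain z where z: "A *v z = 0" "z \<noteq> 0" using matrix_left_invertible_ker by blast
  have "cinn (v i) z = (A *v z) $ i" if "i \<in> I" for i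
    using that by (simp add: cinn_def A_def matrix_vector_mult_def)
  then have zW: "z \<in> W" using z by (simp add: W_def)
  have sub: "subspace W" by (simp add: W_def subspace_def cinn_linear)
  have sa: "(M *v x) \<bullet> y = x \<bullet> (M *v y)" for x y
    using cinn_adjoint[of M x y] h by (simp add: Re_cinn[symmetric])
  have inv: "M *v x \<in> W" if "x \<in> W" for x
  proof -
    have "cinn (v i) (M *v x) = 0" if "i \<in> I" for i
    proof -
      have "cinn (v i) (M *v x) = cinn (M *v v i) x" using cinn_adjoint[of M "v i" x] h by simp
      also have "\<dots> = cnj (cinn x (l i *\<^sub>R v i))" using ev[OF that] by (simp add: cnj_cinn)
      also have "\<dots> = 0" using \<open>x \<in> W\<close> that by (simp add: cinn_linear cnj_cinn W_def)
      finally show ?thesis .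
    qed
    then show ?thesis by (simp add: W_def)
  qed
  obtain x r where x: "x \<in> W" "norm x = 1" "M *v x = r *\<^sub>R x"
    using selfadjoint_eigenvector[OF matrix_vector_linear sub inv sa zW z(2)] .
  have x0: "cinn (v i) x = 0" "cinn x (v i) = 0" if "i \<in> I" for i
    using x(1) that cnj_cinn[of "v i" x] by (auto simp: W_def)
  have xx: "cinn x x = 1" using x(2) by (simp add: cinn_self)
  show ?case
    by (rule exI[of _ "v(k := x)"], rule exI[of _ "l(k := r)"])
      (use insert.hyps on ev x x0 xx in \<open>auto\<close>)
qed

lemma mult_diagm: "(U ** diagm d) $ i $ j = U $ i $ j * d j"
  by (simp add: matrix_matrix_mult_def diagm_def if_distrib[of "\<lambda>x. _ * x"] cong: if_cong)

lemma diagm_mult: "(diagm d ** U) $ i $ j = d i * U $ i $ j"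
  by (simp add: matrix_matrix_mult_def diagm_def if_distrib[of "\<lambda>x. x * _"] cong: if_cong)

lemma cadj_cadj [simp]: "cadj (cadj M) = M"
  by (simp add: cadj_def vec_eq_iff)

lemma cadj_mult: "cadj (M ** N) = cadj N ** cadj M"
  by (simp add: cadj_def vec_eq_iff matrix_matrix_mult_def mult.commute)

theorem spectral_decomposition:
  fixes M :: "'n::finite op"
  assumes "cadj M = M"
  obtains U and l :: "'n \<Rightarrow> real" where "unitary U"
    "M = U ** diagm (\<lambda>i. complex_of_real (l i)) ** cadj U"
proof -
  obtain v and l :: "'n \<Rightarrow> real" where
    on: "\<And>i j. cinn (v i) (v j) = (if i = j then 1 else 0)" and ev: "\<And>i. M *v v i = l i *\<^sub>R v i"
    using orthonormal_eigenvectors[OF assms, of UNIV] by blast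
  define U :: "'n op" where "U = (\<chi> i j. v j $ i)"
  have 1: "cadj U ** U = mat 1"
    using on by (simp add: vec_eq_iff matrix_matrix_mult_def cadj_def U_def mat_def cinn_def)
  then have 2: "U ** cadj U = mat 1" by (simp add: matrix_left_right_inverse)
  have "M ** U = U ** diagm (\<lambda>i. complex_of_real (l i))"
  proof -
    have "(M ** U) $ i $ j = (M *v v j) $ i" for i j
      by (simp add: matrix_matrix_mult_def matrix_vector_mult_def U_def)
    then show ?thesis by (simp add: vec_eq_iff mult_diagm ev U_def scaleR_conv_of_real[where 'a=complex] mult.commute)
  qed
  then have "M ** (U ** cadj U) = U ** diagm (\<lambda>i. complex_of_real (l i)) ** cadj U"
    by (simp add: matrix_mul_assoc)
  with 1 2 that show thesis by (simp add: unitary_def)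
qed

text \<open>If \<open>U diag(l) U* = V diag(k) V*\<close>, then \<open>W = V* U\<close> intertwines the two diagonals, so
  \<open>W i j \<noteq> 0\<close> forces \<open>l j = k i\<close>, and \<open>W\<close> intertwines the images under \<open>f\<close> as well.\<close>
lemma mfun_decomp:
  assumes U: "unitary U"
  shows "mfun f (U ** diagm (\<lambda>i. complex_of_real (l i)) ** cadj U)
       = U ** diagm (\<lambda>i. complex_of_real (f (l i))) ** cadj U"
  unfolding mfun_def
proof (rule some_equality)
  show "\<exists>V k. unitary V \<and> U ** diagm (\<lambda>i. complex_of_real (l i)) ** cadj U =
          V ** diagm (\<lambda>i. complex_of_real (k i)) ** cadj V \<and>
       U ** diagm (\<lambda>i. complex_of_real (f (l i))) ** cadj U =
          V ** diagm (\<lambda>i. complex_of_real (f (k i))) ** cadj V"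
    using U by blast
next
  fix N
  assume "\<exists>V k. unitary V \<and> U ** diagm (\<lambda>i. complex_of_real (l i)) ** cadj U =
          V ** diagm (\<lambda>i. complex_of_real (k i)) ** cadj V \<and>
       N = V ** diagm (\<lambda>i. complex_of_real (f (k i))) ** cadj V"
  then obtain V k where V: "unitary V"
    and eq: "U ** diagm (\<lambda>i. complex_of_real (l i)) ** cadj U =
          V ** diagm (\<lambda>i. complex_of_real (k i)) ** cadj V"
    and N: "N = V ** diagm (\<lambda>i. complex_of_real (f (k i))) ** cadj V" by blast
  define W where "W = cadj V ** U"
  have cU: "A ** cadj U ** U = A" and cV: "cadj V ** (V ** A) = A"
    and cV': "V ** (cadj V ** A) = A" and cU': "A ** U ** cadj U = A" for A
    using U V by (simp_all add: unitary_def matrix_mul_assoc[symmetric])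
      (simp_all add: unitary_def matrix_mul_assoc)
  have "cadj V ** (U ** diagm (\<lambda>i. complex_of_real (l i)) ** cadj U ** U)
      = cadj V ** (V ** diagm (\<lambda>i. complex_of_real (k i)) ** cadj V ** U)" by (simp add: eq)
  then have "W ** diagm (\<lambda>i. complex_of_real (l i)) = diagm (\<lambda>i. complex_of_real (k i)) ** W"
    by (simp only: cU) (simp add: matrix_mul_assoc[symmetric] cV W_def)
  then have "W $ i $ j * of_real (l j) = of_real (k i) * W $ i $ j" for i j
    by (metis mult_diagm diagm_mult)
  then have "W $ i $ j = 0 \<or> l j = k i" for i j
    by (metis mult.commute mult_cancel_left of_real_eq_iff)
  then have "W $ i $ j * of_real (f (l j)) = of_real (f (k i)) * W $ i $ j" for i j
    by (metis mult.commute mult_zero_left)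
  then have "W ** diagm (\<lambda>i. complex_of_real (f (l i))) = diagm (\<lambda>i. complex_of_real (f (k i))) ** W"
    by (simp add: vec_eq_iff mult_diagm diagm_mult)
  then have "V ** (W ** diagm (\<lambda>i. complex_of_real (f (l i)))) ** cadj U
      = V ** (diagm (\<lambda>i. complex_of_real (f (k i))) ** W) ** cadj U" by simp
  then have "U ** diagm (\<lambda>i. complex_of_real (f (l i))) ** cadj U
      = V ** (diagm (\<lambda>i. complex_of_real (f (k i))) ** cadj V ** U) ** cadj U"
    by (simp add: W_def matrix_mul_assoc[symmetric] cV')
  also have "\<dots> = N" unfolding N
    by (metis matrix_mul_assoc cU')
  finally show "N = U ** diagm (\<lambda>i. complex_of_real (f (l i))) ** cadj U" by simp
qed

section \<open>Spectral form and its pointwise algebra\<close>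

definition udiag :: "'n::finite op \<Rightarrow> ('n \<Rightarrow> real) \<Rightarrow> 'n op" where
  "udiag U l = U ** diagm (\<lambda>i. complex_of_real (l i)) ** cadj U"

lemma mfun_udiag: "unitary U \<Longrightarrow> mfun f (udiag U l) = udiag U (\<lambda>i. f (l i))"
  by (simp add: udiag_def mfun_decomp)

lemma cadj_udiag: "cadj (udiag U l) = udiag U l"
proof -
  have "cadj (diagm (\<lambda>i. complex_of_real (l i))) = diagm (\<lambda>i. complex_of_real (l i))"
    by (simp add: cadj_def diagm_def vec_eq_iff)
  then show ?thesis by (simp add: udiag_def cadj_mult matrix_mul_assoc)
qed

lemma diagm_diagm: "diagm a ** diagm b = diagm (\<lambda>i. a i * b i)"
  by (auto simp add: vec_eq_iff mult_diagm) (auto simp: diagm_def)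

lemma udiag_mult:
  assumes "unitary U"
  shows "udiag U a ** udiag U b = udiag U (\<lambda>i. a i * b i)"
proof -
  have "udiag U a ** udiag U b
      = U ** diagm (\<lambda>i. complex_of_real (a i)) ** (cadj U ** U) ** diagm (\<lambda>i. complex_of_real (b i)) ** cadj U"
    by (simp add: udiag_def matrix_mul_assoc)
  also have "\<dots> = U ** (diagm (\<lambda>i. complex_of_real (a i)) ** diagm (\<lambda>i. complex_of_real (b i))) ** cadj U"
    using assms by (simp add: unitary_def matrix_mul_assoc)
  finally show ?thesis by (simp add: diagm_diagm udiag_def)
qed

lemma udiag_one:
  fixes U :: "'n::finite op"
  assumes "unitary U"
  shows "udiag U (\<lambda>_. 1) = mat 1"
proof -
  have "diagm (\<lambda>_. 1) = (mat 1 :: 'n op)" by (simp add: diagm_def mat_def)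
  then show ?thesis using assms by (simp add: udiag_def unitary_def)
qed

text \<open>The matrices on the right are the rank-one spectral projections. They do not depend on
  \<open>l\<close>, so a curve of powers is a sum of scalar curves times fixed matrices and can be
  differentiated termwise.\<close>

lemma udiag_sum: "udiag U l = (\<Sum>k\<in>UNIV. l k *\<^sub>R udiag U (\<lambda>i. if i = k then 1 else 0))"
proof -
  have e: "udiag U f $ i $ j = (\<Sum>k\<in>UNIV. of_real (f k) * (U $ i $ k * cnj (U $ j $ k)))" for f i j
    by (simp add: udiag_def matrix_matrix_mult_def[of _ "cadj U"] mult_diagm) (simp add: cadj_def mult_ac)
  have "(\<Sum>k\<in>UNIV. l k *\<^sub>R udiag U (\<lambda>i. if i = k then 1 else 0)) $ i $ j = udiag U l $ i $ j" for i j
    by (simp add: e if_distrib[of complex_of_real] if_distrib[of "\<lambda>x. x * _"] scaleR_conv_of_real[where 'a=complex] cong: if_cong)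
  then show ?thesis by (simp add: vec_eq_iff)
qed

lemma hermitian_udiag:
  assumes "cadj M = M"
  obtains U l where "unitary U" "M = udiag U l"
  using spectral_decomposition[OF assms] unfolding udiag_def by metis

lemma cadj_mfun: "cadj M = M \<Longrightarrow> cadj (mfun f M) = mfun f M"
  by (metis hermitian_udiag mfun_udiag cadj_udiag)

section \<open>Hermitian and positive operators\<close>

text \<open>Polarisation: \<open>M - cadj M\<close> has zero quadratic form, and testing it on
  combinations of two basis vectors recovers every entry. Since \<open>psd\<close> and
  \<open>posdef\<close> speak only of quadratic forms, this is their access to the spectral
  theorem.\<close>

lemma qform_real_imp_hermitian:
  fixes M :: "'n::finite op"
  assumes "\<And>x. Im (qform M x) = 0"
  shows "cadj M = M"
proof -
  define K where "K = M - cadj M"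
  have lin: "(M - N) *v x = M *v x - N *v x" for N and x :: "complex^'n"
    by (rule matrix_vector_mult_diff_rdistrib)
  have K0: "cinn x (K *v x) = 0" for x
  proof -
    have "cinn x (cadj M *v x) = cnj (cinn x (M *v x))"
      by (simp add: cinn_adjoint[symmetric] cnj_cinn)
    also have "\<dots> = cinn x (M *v x)" using assms[of x] by (simp add: qform_cinn complex_eq_iff)
    finally have "cinn x (cadj M *v x) = cinn x (M *v x)" .
    moreover have "cinn x (a - b) = cinn x a - cinn x b" for a b
      by (simp add: cinn_def sum_subtractf algebra_simps)
    ultimately show ?thesis by (simp add: K_def lin)
  qed
  have entry: "cinn (axis i 1) (K *v axis j 1) = K $ i $ j" for i j
    by (simp add: cinn_def matrix_vector_mult_def axis_def if_distrib[of cnj] if_distrib[of "\<lambda>x. x * _"]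
        if_distrib[of "\<lambda>x. _ * x"] cong: if_cong)
  have pol: "K $ i $ j * c + cnj c * K $ j $ i = 0" for i j c
  proof -
    have add1: "cinn (a + b) y = cinn a y + cinn b y" for a b y :: "complex^'n"
      by (simp add: cinn_def sum.distrib algebra_simps)
    have sc1: "cinn (r *s a) y = cnj r * cinn a y" for r and a y :: "complex^'n"
      by (simp add: cinn_def sum_distrib_left mult_ac)
    have "0 = cinn (axis i 1 + c *s axis j 1) (K *v (axis i 1 + c *s axis j 1))" by (simp add: K0)
    also have "\<dots> = K $ i $ i + c * K $ i $ j + cnj c * (K $ j $ i + c * K $ j $ j)"
      by (simp add: matrix_vector_right_distrib vector_scalar_commute cinn_linear add1 sc1 entry distrib_left)
    finally show ?thesis using K0[of "axis i 1"] K0[of "axis j 1"] by (simp add: entry algebra_simps)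
  qed
  have "K $ i $ j = 0" for i j
    using pol[of i j 1] pol[of i j \<i>] by (simp add: complex_eq_iff)
  then show ?thesis by (simp add: K_def vec_eq_iff)
qed

lemma posdef_imp_psd: "posdef M \<Longrightarrow> psd M"
proof -
  assume M: "posdef M"
  have "Re (qform M x) \<ge> 0" for x
    using M by (cases "x = 0") (auto simp: posdef_def qform_def less_imp_le)
  with M show ?thesis by (simp add: posdef_def psd_def)
qed

lemma psd_hermitian: "psd M \<Longrightarrow> cadj M = M"
  by (rule qform_real_imp_hermitian) (simp add: psd_def)

lemma posdef_hermitian: "posdef M \<Longrightarrow> cadj M = M"
  by (simp add: psd_hermitian posdef_imp_psd)

lemma trace_diagm_mult: "trace (diagm d ** A) = (\<Sum>i\<in>UNIV. d i * A $ i $ i)"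
  by (simp add: trace_def diagm_mult)

lemma qform_column: "qform D (column i U) = (cadj U ** D ** U) $ i $ i"
  by (simp add: qform_def column_def cadj_def matrix_matrix_mult_def sum_distrib_right)
    (rule sum.swap)

text \<open>By cyclicity only the diagonal of \<open>D\<close> in the eigenbasis of the other factor
  is seen, whether or not the two commute. Trace estimates thereby reduce to values of a quadratic
  form on unit vectors.\<close>

lemma trace_mult_udiag:
  "trace (D ** udiag U z) = (\<Sum>i\<in>UNIV. complex_of_real (z i) * qform D (column i U))"
proof -
  have "trace (D ** udiag U z) = trace ((D ** U ** diagm (\<lambda>i. complex_of_real (z i))) ** cadj U)"
    by (simp add: udiag_def matrix_mul_assoc)
  also have "\<dots> = trace ((cadj U ** D ** U) ** diagm (\<lambda>i. complex_of_real (z i)))"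
    by (subst trace_mul_sym) (simp add: matrix_mul_assoc)
  also have "\<dots> = trace (diagm (\<lambda>i. complex_of_real (z i)) ** (cadj U ** D ** U))"
    by (rule trace_mul_sym)
  finally show ?thesis by (simp add: trace_diagm_mult qform_column)
qed

lemma norm_column_unitary: "unitary U \<Longrightarrow> norm (column i U) = 1"
proof -
  assume "unitary U"
  then have "(cadj U ** U) $ i $ i = 1" by (simp add: unitary_def mat_def)
  also have "(cadj U ** U) $ i $ i = cinn (column i U) (column i U)"
    by (simp add: cinn_def column_def cadj_def matrix_matrix_mult_def)
  finally have "(norm (column i U))\<^sup>2 = 1" by (simp only: cinn_self of_real_eq_1_iff)
  then show ?thesis by (simp add: power2_eq_1_iff) (metis norm_ge_zero neg_0_le_iff_le not_one_le_zero)
qed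

lemma qform_udiag_column:
  assumes "unitary U"
  shows "qform (udiag U l) (column i U) = complex_of_real (l i)"
proof -
  have "cadj U ** udiag U l ** U
      = (cadj U ** U) ** diagm (\<lambda>i. complex_of_real (l i)) ** (cadj U ** U)"
    by (simp add: udiag_def matrix_mul_assoc)
  then show ?thesis using assms by (simp add: qform_column unitary_def diagm_def)
qed

lemma trace_udiag: "unitary U \<Longrightarrow> trace (udiag U l) = (\<Sum>i\<in>UNIV. complex_of_real (l i))"
  using trace_mult_udiag[of "mat 1" U l] qform_udiag_column[of U "\<lambda>_. 1"] by (simp add: udiag_one)

lemma psd_eigenvalue: "psd (udiag U l) \<Longrightarrow> unitary U \<Longrightarrow> l i \<ge> 0"
  unfolding psd_def by (metis qform_udiag_column Re_complex_of_real)

lemma posdef_eigenvalue: "posdef (udiag U l) \<Longrightarrow> unitary U \<Longrightarrow> l i > 0"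
  unfolding posdef_def by (metis qform_udiag_column Re_complex_of_real norm_column_unitary norm_zero zero_neq_one)

lemma posdef_udiag_cases:
  assumes "posdef M"
  obtains U l where "unitary U" "M = udiag U l" "\<forall>i. l i > 0"
  using assms hermitian_udiag posdef_hermitian posdef_eigenvalue by metis

lemma mpow_udiag: "unitary U \<Longrightarrow> (\<forall>i. l i > 0) \<Longrightarrow> mpow (udiag U l) s = udiag U (\<lambda>i. l i powr s)"
  by (simp add: mpow_def mfun_udiag)

lemma mpow_0: "posdef M \<Longrightarrow> mpow M 0 = mat 1"
  by (erule posdef_udiag_cases) (simp add: mpow_udiag udiag_one less_imp_neq[symmetric])

lemma mpow_1: "posdef M \<Longrightarrow> mpow M 1 = M"
  by (erule posdef_udiag_cases) (simp add: mpow_udiag less_imp_le)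

definition mln :: "'n::finite op \<Rightarrow> 'n op" where
  "mln M = mfun (\<lambda>x. if x > 0 then ln x else 0) M"

lemma mln_udiag: "unitary U \<Longrightarrow> (\<forall>i. l i > 0) \<Longrightarrow> mln (udiag U l) = udiag U (\<lambda>i. ln (l i))"
  by (simp add: mln_def mfun_udiag)

lemma cadj_mpow: "posdef M \<Longrightarrow> cadj (mpow M s) = mpow M s"
  by (simp add: mpow_def cadj_mfun posdef_hermitian)

text \<open>The base is fixed and only the exponent moves, so the scalar rule applies on each
  spectral projection.\<close>

lemma mpow_has_vector_derivative:
  assumes M: "posdef M" and g: "(g has_real_derivative d) (at t)"
  shows "((\<lambda>a. mpow M (g a)) has_vector_derivative d *\<^sub>R (mpow M (g t) ** mln M)) (at t)"
proof -
  obtain U l where U: "unitary U" and eq: "M = udiag U l" and l: "\<forall>i. l i > 0"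
    by (rule posdef_udiag_cases[OF M])
  let ?E = "\<lambda>k. udiag U (\<lambda>i. if i = k then 1 else 0)"
  have "((\<lambda>a. l k powr g a) has_real_derivative d * (l k powr g t * ln (l k))) (at t)" for k
    using l[rule_format, of k] unfolding powr_def by (auto intro!: derivative_eq_intros g simp: algebra_simps)
  then have "((\<lambda>a. \<Sum>k\<in>UNIV. (l k powr g a) *\<^sub>R ?E k) has_vector_derivative
        (\<Sum>k\<in>UNIV. (d * (l k powr g t * ln (l k))) *\<^sub>R ?E k)) (at t)"
    by (intro has_vector_derivative_sum has_vector_derivative_scaleR[of _ _ _ _ "\<lambda>_. _" 0, simplified])
  moreover have "(\<lambda>a. mpow M (g a)) = (\<lambda>a. \<Sum>k\<in>UNIV. (l k powr g a) *\<^sub>R ?E k)"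
    by (rule ext, subst udiag_sum[symmetric]) (simp add: eq mpow_udiag U l)
  moreover have "d *\<^sub>R (mpow M (g t) ** mln M) = (\<Sum>k\<in>UNIV. (d * (l k powr g t * ln (l k))) *\<^sub>R ?E k)"
    by (simp add: eq mpow_udiag mln_udiag U l udiag_mult) (subst udiag_sum, simp add: scaleR_sum_right)
  ultimately show ?thesis by simp
qed

subsection \<open>Trace inequalities\<close>

text \<open>The weights are \<open>\<bar>\<langle>u\<^sub>i, v\<^sub>j\<rangle>\<bar>\<^sup>2\<close> for the two eigenbases; they reduce trace inequalities
  for noncommuting operators to scalar ones.\<close>
lemma trace_udiag_mult_udiag:
  fixes U V :: "'n::finite op"
  assumes U: "unitary U" and V: "unitary V"
  obtains w :: "'n \<Rightarrow> 'n \<Rightarrow> real" where "\<forall>i j. w i j \<ge> 0" "\<forall>i. (\<Sum>j\<in>UNIV. w i j) = 1" "\<forall>j. (\<Sum>i\<in>UNIV. w i j) = 1"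
    "\<forall>f g. Re (trace (udiag U f ** udiag V g)) = (\<Sum>i\<in>UNIV. \<Sum>j\<in>UNIV. w i j * (f i * g j))"
proof -
  define W where "W = cadj U ** V"
  define w where "w i j = (cmod (W $ i $ j))\<^sup>2" for i j
  have w: "complex_of_real (w i j) = W $ i $ j * cnj (W $ i $ j)" for i j
    unfolding w_def by (rule complex_norm_square)
  have "W ** cadj W = cadj U ** (V ** cadj V) ** U" "cadj W ** W = cadj V ** (U ** cadj U) ** V"
    by (simp_all add: W_def cadj_mult matrix_mul_assoc)
  then have WW: "W ** cadj W = mat 1" "cadj W ** W = mat 1"
    using U V by (simp_all add: unitary_def)
  have r: "(\<Sum>j\<in>UNIV. w i j) = 1" for i
  proof -
    have "complex_of_real (\<Sum>j\<in>UNIV. w i j) = (W ** cadj W) $ i $ i"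
      by (simp add: w matrix_matrix_mult_def cadj_def)
    also have "\<dots> = complex_of_real 1" by (simp add: WW mat_def)
    finally show ?thesis by (simp only: of_real_eq_iff)
  qed
  have c: "(\<Sum>i\<in>UNIV. w i j) = 1" for j
  proof -
    have "complex_of_real (\<Sum>i\<in>UNIV. w i j) = (cadj W ** W) $ j $ j"
      by (simp add: w matrix_matrix_mult_def cadj_def mult.commute)
    also have "\<dots> = complex_of_real 1" by (simp add: WW mat_def)
    finally show ?thesis by (simp only: of_real_eq_iff)
  qed
  have t: "trace (udiag U f ** udiag V g) = complex_of_real (\<Sum>i\<in>UNIV. \<Sum>j\<in>UNIV. w i j * (f i * g j))" for f g
  proof -
    have "trace (udiag U f ** udiag V g)
       = trace (U ** (diagm (\<lambda>i. complex_of_real (f i)) ** cadj U ** udiag V g))"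
      by (simp add: udiag_def matrix_mul_assoc)
    also have "\<dots> = trace (diagm (\<lambda>i. complex_of_real (f i)) **
        (W ** diagm (\<lambda>i. complex_of_real (g i)) ** cadj W))"
      by (subst trace_mul_sym) (simp add: udiag_def W_def cadj_mult matrix_mul_assoc)
    also have "\<dots> = (\<Sum>i\<in>UNIV. of_real (f i) * (\<Sum>j\<in>UNIV. W $ i $ j * of_real (g j) * cnj (W $ i $ j)))"
      by (simp add: trace_diagm_mult matrix_matrix_mult_def[of _ "cadj W"] mult_diagm) (simp add: cadj_def)
    finally show ?thesis by (simp add: w sum_distrib_left mult_ac)
  qed
  show thesis by (rule that[of w]) (simp_all add: r c t, simp add: w_def)
qed

lemma qform_bound: "cmod (qform D x) \<le> (\<Sum>i\<in>UNIV. \<Sum>j\<in>UNIV. cmod (D $ i $ j)) * (norm x)\<^sup>2"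
proof -
  have "cmod (qform D x) \<le> (\<Sum>i\<in>UNIV. \<Sum>j\<in>UNIV. cmod (cnj (x $ i) * D $ i $ j * x $ j))"
    unfolding qform_def by (intro order_trans[OF norm_sum] sum_mono order_refl)
  also have "\<dots> \<le> (\<Sum>i\<in>UNIV. \<Sum>j\<in>UNIV. cmod (D $ i $ j) * (norm x)\<^sup>2)"
  proof (intro sum_mono)
    fix i j
    have "cmod (x $ i) * cmod (x $ j) \<le> norm x * norm x"
      by (intro mult_mono Finite_Cartesian_Product.norm_nth_le) auto
    from mult_left_mono[OF this, of "cmod (D $ i $ j)"]
    show "cmod (cnj (x $ i) * D $ i $ j * x $ j) \<le> cmod (D $ i $ j) * (norm x)\<^sup>2"
      by (simp add: norm_mult power2_eq_square mult_ac)
  qed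
  finally show ?thesis by (simp add: sum_distrib_right)
qed

text \<open>For \<open>a \<le> 1\<close> this is weighted AM-GM for \<open>x powr (1 / a)\<close>
  and \<open>s\<close> with weights \<open>a\<close> and \<open>1 - a\<close>; the factor
  \<open>1 - a\<close> in front encodes the reversal beyond 1.\<close>

lemma powr_young:
  fixes x s a :: real
  assumes x: "x > 0" and s: "s > 0" and a: "a > 0"
  shows "0 \<le> (1 - a) * (a * x powr (1 / a) + (1 - a) * s - x * s powr (1 - a))"
proof (cases "a \<le> 1")
  case True
  have "(x powr (1 / a)) powr a * s powr (1 - a) \<le> a * x powr (1 / a) + (1 - a) * s"
    using assms True by (intro Youngs_inequality_0) auto
  then show ?thesis using True a x by (simp add: powr_powr)
next
  case False
  \<comment> \<open>AM-GM is now applied to \<open>?u\<close> and \<open>s\<close> with weights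
    \<open>1 / a\<close> and \<open>1 - 1 / a\<close>, under which the powers of \<open>s\<close>
    cancel and \<open>x powr (1 / a)\<close> remains.\<close>
  let ?u = "x * s powr (1 - a)"
  have u: "?u > 0" using x s by simp
  have "?u powr (1 / a) * s powr (1 - 1 / a) \<le> (1 / a) * ?u + (1 - 1 / a) * s"
    using False u s by (intro Youngs_inequality_0) auto
  moreover have "?u powr (1 / a) * s powr (1 - 1 / a) = x powr (1 / a)"
  proof -
    have "?u powr (1 / a) = x powr (1 / a) * s powr ((1 - a) / a)"
      using x s by (simp add: powr_mult powr_powr)
    moreover have "s powr ((1 - a) / a) * s powr (1 - 1 / a) = 1"
      using s a by (simp add: powr_add[symmetric] field_simps)
    ultimately show ?thesis by (simp add: mult.assoc)
  qed
  ultimately have "a * x powr (1 / a) \<le> a * ((1 / a) * ?u + (1 - 1 / a) * s)"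
    using a by (intro mult_left_mono) auto
  also have "\<dots> = ?u + (a - 1) * s" using a by (simp add: field_simps)
  finally show ?thesis using False by (intro mult_nonpos_nonpos) (auto simp: algebra_simps)
qed

lemma trace_young:
  fixes X S :: "'n::finite op"
  assumes X: "posdef X" and S: "posdef S" and a: "a > 0"
  shows "0 \<le> (1 - a) * (a * Re (trace (mpow X (1 / a))) + (1 - a) * Re (trace S)
            - Re (trace (X ** mpow S (1 - a))))"
proof -
  obtain U x where U: "unitary U" and Xe: "X = udiag U x" and x: "\<forall>i. x i > 0"
    by (rule posdef_udiag_cases[OF X])
  obtain V s where V: "unitary V" and Se: "S = udiag V s" and s: "\<forall>i. s i > 0"
    by (rule posdef_udiag_cases[OF S])
  obtain w :: "'n \<Rightarrow> 'n \<Rightarrow> real" where w: "\<forall>i j. w i j \<ge> 0"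
    and r: "\<forall>i. (\<Sum>j\<in>UNIV. w i j) = 1" and c: "\<forall>j. (\<Sum>i\<in>UNIV. w i j) = 1"
    and t: "\<forall>f g. Re (trace (udiag U f ** udiag V g)) = (\<Sum>i\<in>UNIV. \<Sum>j\<in>UNIV. w i j * (f i * g j))"
    by (rule trace_udiag_mult_udiag[OF U V])
  have r': "(\<Sum>j\<in>UNIV. w i j * z) = z" and c': "(\<Sum>i\<in>UNIV. w i j * z) = z" for i j z
    by (simp_all only: sum_distrib_right[symmetric] r[rule_format] c[rule_format] mult_1)
  have 1: "Re (trace (mpow X (1 / a))) = (\<Sum>i\<in>UNIV. \<Sum>j\<in>UNIV. w i j * (x i powr (1 / a)))"
    by (simp add: Xe mpow_udiag U x trace_udiag r')
  have 2: "Re (trace S) = (\<Sum>i\<in>UNIV. \<Sum>j\<in>UNIV. w i j * s j)"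
    by (subst sum.swap) (simp add: Se V trace_udiag c')
  have 3: "Re (trace (X ** mpow S (1 - a))) = (\<Sum>i\<in>UNIV. \<Sum>j\<in>UNIV. w i j * (x i * s j powr (1 - a)))"
    by (simp add: Xe Se mpow_udiag V s t)
  have "0 \<le> (\<Sum>i\<in>UNIV. \<Sum>j\<in>UNIV. w i j * ((1 - a) * (a * x i powr (1 / a) + (1 - a) * s j - x i * s j powr (1 - a))))"
    by (intro sum_nonneg mult_nonneg_nonneg w[rule_format] powr_young x[rule_format] s[rule_format] a)
  also have "\<dots> = (1 - a) * (a * Re (trace (mpow X (1 / a))) + (1 - a) * Re (trace S)
            - Re (trace (X ** mpow S (1 - a))))"
    unfolding 1 2 3 by (simp add: sum_distrib_left sum.distrib sum_subtractf algebra_simps)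
  finally show ?thesis .
qed

text \<open>Each eigenvector of \<open>S\<close> contributes a positive weight times a positive
  value of the form of \<open>X\<close>. Positivity is what allows logarithms of these traces to be
  compared.\<close>

lemma trace_mult_mpow_pos:
  fixes X S :: "'n::finite op"
  assumes X: "posdef X" and S: "posdef S"
  shows "Re (trace (X ** mpow S r)) > 0"
proof -
  obtain V s where V: "unitary V" and Se: "S = udiag V s" and s: "\<forall>i. s i > 0"
    by (rule posdef_udiag_cases[OF S])
  have "Re (qform X (column i V)) > 0" for i
    using X norm_column_unitary[OF V, of i] unfolding posdef_def by (metis norm_zero zero_neq_one)
  then show ?thesis
    by (simp add: Se mpow_udiag V s trace_mult_udiag) (intro sum_pos, auto simp: s less_imp_neq[symmetric])
qed

section \<open>Marginals\<close>

lemma sum_UNIV_prod: "(\<Sum>p\<in>UNIV. f p) = (\<Sum>a\<in>UNIV. \<Sum>b\<in>UNIV. f (a, b))"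
  for f :: "'a::finite \<times> 'b::finite \<Rightarrow> 'z::comm_monoid_add"
  by (simp add: sum.cartesian_product)

lemma sum_if_const: "(\<Sum>x\<in>A. if P then f x else 0) = (if P then \<Sum>x\<in>A. f x else 0)"
  for f :: "'a \<Rightarrow> 'z::comm_monoid_add"
  by simp

lemma trace_mult_eq: "trace (A ** B) = (\<Sum>i\<in>UNIV. \<Sum>j\<in>UNIV. A $ i $ j * B $ j $ i)"
  by (simp add: trace_def matrix_matrix_mult_def)

lemmas if_mult = if_distrib[of "\<lambda>x. _ * x"] if_distrib[of "\<lambda>x. x * _"]

text \<open>The partial trace is the adjoint of tensoring with the identity. In this form, and in
  its AC and C versions, marginals enter the arguments on positivity, traces and entropies.\<close>

lemma trace_marg_BC: "trace (Z ** ext_BC S) = trace (marg_BC Z ** S)"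
proof -
  have "trace (Z ** ext_BC S) = (\<Sum>a\<in>UNIV. \<Sum>i\<in>UNIV. \<Sum>j\<in>UNIV. Z $ (a, i) $ (a, j) * S $ j $ i)"
    by (simp add: trace_mult_eq sum_UNIV_prod[where 'b="'b \<times> 'c"] ext_BC_def if_mult sum_if_const sum.delta cong: if_cong)
  also have "\<dots> = (\<Sum>i\<in>UNIV. \<Sum>j\<in>UNIV. \<Sum>a\<in>UNIV. Z $ (a, i) $ (a, j) * S $ j $ i)"
    by (subst sum.swap, intro sum.cong refl, subst sum.swap, rule refl)
  finally show ?thesis by (simp add: trace_mult_eq marg_BC_def sum_distrib_right)
qed

lemma trace_marg_AC: "trace (Z ** ext_AC S) = trace (marg_AC Z ** S)"
proof -
  have "trace (Z ** ext_AC S) = (\<Sum>a\<in>UNIV. \<Sum>b\<in>UNIV. \<Sum>c\<in>UNIV. \<Sum>a'\<in>UNIV. \<Sum>c'\<in>UNIV.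
      Z $ (a, b, c) $ (a', b, c') * S $ (a', c') $ (a, c))"
    by (simp add: trace_mult_eq sum_UNIV_prod ext_AC_def if_mult sum_if_const sum.delta cong: if_cong)
  also have "\<dots> = (\<Sum>a\<in>UNIV. \<Sum>c\<in>UNIV. \<Sum>a'\<in>UNIV. \<Sum>c'\<in>UNIV. \<Sum>b\<in>UNIV.
      Z $ (a, b, c) $ (a', b, c') * S $ (a', c') $ (a, c))"
    by (intro sum.cong refl, subst sum.swap, intro sum.cong refl, subst sum.swap,
        intro sum.cong refl, subst sum.swap, rule refl)
  finally show ?thesis by (simp add: trace_mult_eq sum_UNIV_prod marg_AC_def sum_distrib_right)
qed

lemma trace_marg_C: "trace (Z ** ext_C S) = trace (marg_C Z ** S)"
proof -
  have "trace (Z ** ext_C S) = (\<Sum>a\<in>UNIV. \<Sum>b\<in>UNIV. \<Sum>c\<in>UNIV. \<Sum>c'\<in>UNIV.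
      Z $ (a, b, c) $ (a, b, c') * S $ c' $ c)"
  proof -
    have "(if a = a' \<and> b = b' then x else 0) = (if a = a' then if b = b' then x else 0 else 0)"
      for a a' :: 'a and b b' :: 'b and x :: complex by simp
    then show ?thesis
      by (simp add: trace_mult_eq sum_UNIV_prod ext_C_def if_mult sum_if_const sum.delta cong: if_cong)
  qed
  also have "\<dots> = (\<Sum>a\<in>UNIV. \<Sum>c\<in>UNIV. \<Sum>c'\<in>UNIV. \<Sum>b\<in>UNIV. Z $ (a, b, c) $ (a, b, c') * S $ c' $ c)"
    by (intro sum.cong refl, subst sum.swap, intro sum.cong refl, subst sum.swap, rule refl)
  also have "\<dots> = (\<Sum>c\<in>UNIV. \<Sum>c'\<in>UNIV. \<Sum>a\<in>UNIV. \<Sum>b\<in>UNIV. Z $ (a, b, c) $ (a, b, c') * S $ c' $ c)"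
    by (subst sum.swap, intro sum.cong refl, subst sum.swap, rule refl)
  finally show ?thesis by (simp add: trace_mult_eq marg_C_def sum_distrib_right)
qed

section \<open>Positivity of marginals\<close>

definition outer :: "complex^'n::finite \<Rightarrow> 'n op" where
  "outer x = (\<chi> i j. x $ i * cnj (x $ j))"

lemma qform_outer: "qform M x = trace (M ** outer x)"
  by (simp add: qform_def trace_mult_eq outer_def mult_ac)

lemma matrix_mult_sum_right: "(M :: 'n::finite op) ** (\<Sum>k\<in>K. f k) = (\<Sum>k\<in>K. M ** f k)"
  by (induction K rule: infinite_finite_induct) (simp_all add: matrix_add_ldistrib)

lemma trace_sum: "trace (\<Sum>k\<in>K. f k) = (\<Sum>k\<in>K. trace (f k))"
  by (simp add: trace_def, rule sum.swap)

text \<open>One argument for all three marginals. The identity tensored with the projector onto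
  \<open>y\<close> is the sum of the rank-one operators of e_k tensor y over a basis e_k of the
  traced-out system, so the form of the marginal at \<open>y\<close> is the sum of the forms of
  \<open>M\<close> at these vectors \<open>z k y\<close>.\<close>

lemma posdef_marginal:
  fixes M :: "'m::finite op" and N :: "'n::finite op" and z :: "'k::finite \<Rightarrow> complex^'n \<Rightarrow> complex^'m"
  assumes M: "posdef M" and adj: "\<And>S. trace (M ** e S) = trace (N ** S)"
    and dec: "\<And>y. e (outer y) = (\<Sum>k\<in>UNIV. outer (z k y))" and nz: "\<And>k y. y \<noteq> 0 \<Longrightarrow> z k y \<noteq> 0"
  shows "posdef N"
proof -
  have q: "qform N y = (\<Sum>k\<in>UNIV. qform M (z k y))" for y
    by (simp add: qform_outer adj[symmetric] dec matrix_mult_sum_right trace_sum)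
  show ?thesis using M nz unfolding posdef_def q by (auto intro!: sum_pos)
qed

lemma posdef_marg_BC: "posdef M \<Longrightarrow> posdef (marg_BC M)"
proof (erule posdef_marginal[where e = ext_BC and z = "\<lambda>a y. \<chi> p. if fst p = a then y $ snd p else 0"])
  show "ext_BC (outer y) = (\<Sum>a\<in>UNIV. outer (\<chi> p. if fst p = a then y $ snd p else 0))" for y :: "complex^('b \<times> 'c)"
    by (auto simp: vec_eq_iff ext_BC_def outer_def if_mult if_distrib[of cnj] cong: if_cong)
next
  show "(\<chi> p. if fst p = a then y $ snd p else 0) \<noteq> 0" if "y \<noteq> 0" for a and y :: "complex^('b \<times> 'c)"
    using that by (auto simp: vec_eq_iff)
qed (rule trace_marg_BC)

lemma posdef_marg_AC: "posdef M \<Longrightarrow> posdef (marg_AC M)"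
proof (erule posdef_marginal[where e = ext_AC and
      z = "\<lambda>b y. \<chi> p. if fst (snd p) = b then y $ (fst p, snd (snd p)) else 0"])
  show "ext_AC (outer y) = (\<Sum>b\<in>UNIV. outer (\<chi> p. if fst (snd p) = b then y $ (fst p, snd (snd p)) else 0))"
    for y :: "complex^('a \<times> 'c)"
    by (auto simp: vec_eq_iff ext_AC_def outer_def if_mult if_distrib[of cnj] cong: if_cong)
next
  show "(\<chi> p. if fst (snd p) = b then y $ (fst p, snd (snd p)) else 0) \<noteq> 0" if "y \<noteq> 0"
    for b and y :: "complex^('a \<times> 'c)"
    using that by (auto simp: vec_eq_iff)
qed (rule trace_marg_AC)

lemma posdef_marg_C: "posdef M \<Longrightarrow> posdef (marg_C M)"
proof (erule posdef_marginal[where e = ext_C and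
      z = "\<lambda>k y. \<chi> p. if (fst p, fst (snd p)) = k then y $ snd (snd p) else 0"])
  show "ext_C (outer y) = (\<Sum>k\<in>UNIV. outer (\<chi> p. if (fst p, fst (snd p)) = k then y $ snd (snd p) else 0))"
    for y :: "complex^'c"
    by (auto simp: vec_eq_iff ext_C_def outer_def if_mult if_distrib[of cnj] cong: if_cong)
next
  show "(\<chi> p. if (fst p, fst (snd p)) = k then y $ snd (snd p) else 0) \<noteq> 0" if "y \<noteq> 0"
    for k and y :: "complex^'c"
    using that by (cases k) (auto simp: vec_eq_iff)
qed (rule trace_marg_C)

lemma ext_one [simp]:
  "ext_AC (mat 1) = mat 1" "ext_BC (mat 1) = mat 1" "ext_C (mat 1) = mat 1"
  by (auto simp: vec_eq_iff ext_AC_def ext_BC_def ext_C_def mat_def prod_eq_iff)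

lemma trace_marg_BC_eq: "trace (marg_BC M) = trace M"
  using trace_marg_BC[of M "mat 1"] by simp

lemma cadj_ext:
  "cadj (ext_AC X) = ext_AC (cadj X)" "cadj (ext_C Z) = ext_C (cadj Z)"
  by (auto simp: vec_eq_iff ext_AC_def ext_C_def cadj_def)

lemma cadj_marg_BC: "cadj (marg_BC M) = marg_BC (cadj M)"
  by (simp add: vec_eq_iff marg_BC_def cadj_def)

lemma ext_BC_mult: "ext_BC (S ** T) = ext_BC S ** ext_BC T"
  by (auto simp: vec_eq_iff ext_BC_def matrix_matrix_mult_def sum_UNIV_prod[where 'b="'b \<times> 'c"] if_mult
      sum_if_const sum.delta cong: if_cong)

section \<open>Eigenvalue bounds and invertibility\<close>

lemma qform_udiag:
  "qform (udiag U l) x = complex_of_real (\<Sum>i\<in>UNIV. l i * (cmod ((cadj U *v x) $ i))\<^sup>2)"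
proof -
  let ?D = "diagm (\<lambda>i. complex_of_real (l i))" and ?y = "cadj U *v x"
  have "qform (udiag U l) x = cinn x (cadj (cadj U) *v (?D *v ?y))"
    by (simp add: qform_cinn udiag_def matrix_vector_mul_assoc[symmetric])
  also have "\<dots> = cinn ?y (?D *v ?y)" by (simp only: cinn_adjoint)
  also have "(?D *v ?y) = (\<chi> i. of_real (l i) * ?y $ i)"
    by (simp add: vec_eq_iff) (simp add: matrix_vector_mult_def[of _ "cadj U *v x"] diagm_def if_mult cong: if_cong)
  finally show ?thesis
    by (simp add: cinn_def complex_norm_square[unfolded of_real_power[symmetric]] mult_ac
        complex_norm_square del: of_real_power)
qed

lemma sum_cadj_unitary:
  assumes "unitary U"
  shows "(\<Sum>i\<in>UNIV. (cmod ((cadj U *v x) $ i))\<^sup>2) = (norm x)\<^sup>2"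
proof -
  have "complex_of_real (\<Sum>i\<in>UNIV. 1 * (cmod ((cadj U *v x) $ i))\<^sup>2) = qform (mat 1) x"
    by (simp only: qform_udiag[symmetric] udiag_one[OF assms])
  also have "\<dots> = complex_of_real ((norm x)\<^sup>2)" by (simp add: qform_cinn cinn_self)
  finally show ?thesis by (simp only: of_real_eq_iff mult_1)
qed

text \<open>On unit vectors the form is a convex combination of the eigenvalues, so the smallest and
  the largest of them serve as bounds.\<close>

lemma posdef_bounds:
  assumes "posdef Y"
  obtains c C where "c > 0" "\<forall>x. norm x = 1 \<longrightarrow> c \<le> Re (qform Y x) \<and> Re (qform Y x) \<le> C"
proof -
  obtain U l where U: "unitary U" and Y: "Y = udiag U l" and l: "\<forall>i. l i > 0"
    by (rule posdef_udiag_cases[OF assms])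
  let ?c = "Min (range l)" and ?C = "Max (range l)"
  have b: "?c \<le> l i" "l i \<le> ?C" for i by simp_all
  have "?c \<le> Re (qform Y x) \<and> Re (qform Y x) \<le> ?C" if "norm x = 1" for x
  proof -
    let ?w = "\<lambda>i. (cmod ((cadj U *v x) $ i))\<^sup>2"
    have w: "(\<Sum>i\<in>UNIV. ?w i) = 1" using sum_cadj_unitary[OF U, of x] that by simp
    have "(\<Sum>i\<in>UNIV. ?c * ?w i) \<le> (\<Sum>i\<in>UNIV. l i * ?w i)" "(\<Sum>i\<in>UNIV. l i * ?w i) \<le> (\<Sum>i\<in>UNIV. ?C * ?w i)"
      by (intro sum_mono mult_right_mono b; simp)+
    then show ?thesis by (simp add: Y qform_udiag sum_distrib_left[symmetric] w)
  qed
  moreover have "?c > 0" using l by simp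
  ultimately show thesis using that by blast
qed

lemma posdef_udiag:
  assumes U: "unitary U" and l: "\<forall>i. l i > 0"
  shows "posdef (udiag U l)"
proof -
  have "(\<Sum>i\<in>UNIV. l i * (cmod ((cadj U *v x) $ i))\<^sup>2) > 0" if "x \<noteq> 0" for x
  proof -
    have "(norm x)\<^sup>2 \<noteq> 0" using that by simp
    then have "\<exists>i. (cmod ((cadj U *v x) $ i))\<^sup>2 \<noteq> 0"
      unfolding sum_cadj_unitary[OF U, symmetric] by (meson sum.neutral)
    then obtain i where "(cmod ((cadj U *v x) $ i))\<^sup>2 > 0" by (auto simp: less_le)
    then have "0 < l i * (cmod ((cadj U *v x) $ i))\<^sup>2" using l by simp
    then show ?thesis by (intro sum_pos2[of _ i]) (auto simp: l less_imp_le)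
  qed
  then show ?thesis by (simp add: posdef_def qform_udiag)
qed

lemma posdef_mpow: "posdef M \<Longrightarrow> posdef (mpow M s)"
  by (erule posdef_udiag_cases) (simp add: mpow_udiag, rule posdef_udiag, auto simp: less_imp_neq[symmetric])

lemma psd_right_invertible_imp_posdef:
  fixes S :: "'n::finite op"
  assumes S: "psd S" and B: "S ** B = mat 1"
  shows "posdef S"
proof -
  obtain U l where U: "unitary U" and eq: "S = udiag U l"
    using hermitian_udiag[OF psd_hermitian[OF S]] by metis
  have "l i > 0" for i
  proof -
    let ?D = "diagm (\<lambda>i. complex_of_real (l i))"
    have "cadj U ** (S ** B) ** U = (cadj U ** U) ** (?D ** (cadj U ** B ** U))"
      by (simp add: eq udiag_def matrix_mul_assoc)
    then have "?D ** (cadj U ** B ** U) = mat 1" using U by (simp add: B unitary_def)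
    then have "(?D ** (cadj U ** B ** U)) $ i $ i = 1" by (simp add: mat_def)
    then have "l i \<noteq> 0" by (auto simp: diagm_mult)
    moreover have "l i \<ge> 0" using psd_eigenvalue[of U l i] S U eq by simp
    ultimately show ?thesis by simp
  qed
  then show ?thesis using posdef_udiag[OF U] eq by simp
qed

lemma posdef_right_inverse:
  assumes "posdef M"
  obtains B where "M ** B = mat 1"
proof -
  obtain U l where U: "unitary U" and Y: "M = udiag U l" and l: "\<forall>i. l i > 0"
    by (rule posdef_udiag_cases[OF assms])
  have "M ** udiag U (\<lambda>i. inverse (l i)) = mat 1"
    using l by (simp add: Y U udiag_mult less_imp_neq[symmetric] udiag_one)
  then show thesis using that by blast
qed

section \<open>Supports and admissible states\<close>

lemma supp_eq_UNIV_iff: "supp (M :: 'n::finite op) = UNIV \<longleftrightarrow> (\<exists>B. M ** B = mat 1)"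
  unfolding supp_def by (metis matrix_right_invertible_surjective)

lemma supp_ext_BC_UNIV_iff:
  "supp (ext_BC S :: ('a::finite \<times> 'b::finite \<times> 'c::finite) op) = UNIV \<longleftrightarrow> supp S = UNIV"
proof
  assume R: "supp S = UNIV"
  then obtain B where "S ** B = mat 1" by (auto simp: supp_eq_UNIV_iff)
  then have "(ext_BC S :: ('a \<times> 'b \<times> 'c) op) ** ext_BC B = mat 1"
    by (simp add: ext_BC_mult[symmetric])
  then show "supp (ext_BC S :: ('a \<times> 'b \<times> 'c) op) = UNIV" by (auto simp: supp_eq_UNIV_iff)
next
  assume L: "supp (ext_BC S :: ('a \<times> 'b \<times> 'c) op) = UNIV"
  have "y \<in> supp S" for y
  proof -
    \<comment> \<open>All slices of this vector over the first index equal \<open>y\<close>, so each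
      slice of a preimage under \<open>ext_BC S\<close> is a preimage of \<open>y\<close> under
      \<open>S\<close>; an arbitrary index \<open>a\<close> picks one.\<close>
    have "(\<chi> p. y $ snd p) \<in> supp (ext_BC S :: ('a \<times> 'b \<times> 'c) op)" using L by simp
    then obtain x where x: "(\<chi> p. y $ snd p) = (ext_BC S :: ('a \<times> 'b \<times> 'c) op) *v x"
      by (auto simp: supp_def)
    define a :: 'a where "a = undefined"
    have "y $ i = (S *v (\<chi> j. x $ (a, j))) $ i" for i
    proof -
      have "y $ i = ((ext_BC S :: ('a \<times> 'b \<times> 'c) op) *v x) $ (a, i)" by (simp add: x[symmetric])
      then show ?thesis
        by (simp add: matrix_vector_mult_def ext_BC_def sum_UNIV_prod[where 'b="'b \<times> 'c"] if_mult
            sum_if_const sum.delta' cong: if_cong)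
    qed
    then have "y = S *v (\<chi> j. x $ (a, j))" by (simp add: vec_eq_iff)
    then show ?thesis by (auto simp: supp_def)
  qed
  then show "supp S = UNIV" by blast
qed

text \<open>A positive definite \<rho> has full support, which forces full support on \<sigma>.
  Every competitor in the infimum is then positive definite and its powers have no kernel to be
  treated separately.\<close>

lemma admissible_states:
  fixes \<rho> :: "('a::finite \<times> 'b::finite \<times> 'c::finite) op"
  assumes "posdef \<rho>"
  shows "{\<sigma>. density_op \<sigma> \<and> supp \<rho> \<subseteq> supp (ext_BC \<sigma> :: ('a \<times> 'b \<times> 'c) op)} = {\<sigma>. posdef \<sigma> \<and> trace \<sigma> = 1}"
proof -
  have inv: "posdef M \<Longrightarrow> supp M = UNIV" for M :: "'n::finite op"
    by (metis posdef_right_inverse supp_eq_UNIV_iff)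
  have "supp \<rho> = UNIV" by (rule inv[OF assms])
  moreover have "psd \<sigma> \<and> supp \<sigma> = UNIV \<longleftrightarrow> posdef \<sigma>" for \<sigma> :: "('b \<times> 'c) op"
    by (metis inv psd_right_invertible_imp_posdef supp_eq_UNIV_iff posdef_imp_psd)
  ultimately show ?thesis by (auto simp: density_op_def top.extremum_unique supp_ext_BC_UNIV_iff)
qed

section \<open>The limit\<close>

lemma matrix_scaleR:
  fixes A B :: "'n::finite op"
  shows "(r *\<^sub>R A) ** B = r *\<^sub>R (A ** B)" "A ** (r *\<^sub>R B) = r *\<^sub>R (A ** B)"
  by (simp_all add: vec_eq_iff matrix_matrix_mult_def scaleR_sum_right)

lemma matrix_add_rdistrib: "(A + B) ** C = A ** C + B ** (C :: 'n::finite op)"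
  by (simp add: vec_eq_iff matrix_matrix_mult_def sum.distrib algebra_simps)

lemma bounded_bilinear_matrix_mult: "bounded_bilinear (\<lambda>A B. (A :: 'n::finite op) ** (B :: 'n op))"
  unfolding bilinear_conv_bounded_bilinear[symmetric] bilinear_def
  by (auto intro!: linearI simp: matrix_scaleR matrix_add_ldistrib matrix_add_rdistrib)

lemma bounded_linear_op:
  "bounded_linear (\<lambda>M :: 'n::finite op. Re (trace M))"
  "bounded_linear (marg_BC :: ('a::finite \<times> 'b::finite \<times> 'c::finite) op \<Rightarrow> _)"
  "bounded_linear (ext_AC :: _ \<Rightarrow> ('a::finite \<times> 'b::finite \<times> 'c::finite) op)"
  "bounded_linear (ext_C :: _ \<Rightarrow> ('a::finite \<times> 'b::finite \<times> 'c::finite) op)"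
  by (auto intro!: linearI simp: linear_conv_bounded_linear[symmetric] vec_eq_iff trace_def sum.distrib
      scaleR_sum_right sum_distrib_left marg_BC_def ext_AC_def ext_C_def)

section \<open>Perturbation of a positive definite operator\<close>

definition entry_norm :: "'n::finite op \<Rightarrow> real" where
  "entry_norm D = (\<Sum>i\<in>UNIV. \<Sum>j\<in>UNIV. cmod (D $ i $ j))"

lemma tendsto_entry_norm:
  assumes "(X \<longlongrightarrow> Y) F"
  shows "((\<lambda>a. entry_norm (X a - Y)) \<longlongrightarrow> 0) F"
proof -
  have "((\<lambda>a. entry_norm (X a - Y)) \<longlongrightarrow> entry_norm (Y - Y)) F"
    unfolding entry_norm_def by (intro tendsto_intros assms)
  then show ?thesis by (simp add: entry_norm_def)
qed

lemma qform_diff: "qform (A - B) x = qform A x - qform B x"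
  by (simp add: qform_def sum_subtractf algebra_simps)

lemma abs_powr_minus_one_le:
  fixes x r :: real
  assumes "x > 0" "\<bar>ln x\<bar> \<le> b" "\<bar>r\<bar> * b \<le> 1"
  shows "\<bar>x powr r - 1\<bar> \<le> 2 * b * \<bar>r\<bar>"
proof -
  let ?u = "r * ln x"
  have 1: "\<bar>?u\<bar> \<le> \<bar>r\<bar> * b" using assms by (simp add: abs_mult mult_left_mono)
  \<comment> \<open>For \<open>?u \<ge> 0\<close> the quadratic bound on \<open>exp\<close> together
    with \<open>?u\<^sup>2 \<le> ?u\<close> gives the factor 2; for negative \<open>?u\<close>
    already \<open>1 - exp ?u \<le> - ?u\<close>.\<close>
  have "\<bar>exp ?u - 1\<bar> \<le> 2 * \<bar>?u\<bar>"
  proof (cases "?u \<ge> 0")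
    case True
    have "?u\<^sup>2 \<le> ?u" using 1 assms(3) True by (simp add: power2_eq_square mult_left_le)
    then show ?thesis using exp_bound[of ?u] 1 assms(3) True exp_ge_add_one_self[of ?u] by linarith
  next
    case False
    then show ?thesis using exp_ge_add_one_self[of ?u] exp_le_one_iff[of ?u] by linarith
  qed
  then show ?thesis using 1 assms(1) by (simp add: powr_def mult_ac)
qed

text \<open>An eigenvalue of \<open>X\<close> is the form of \<open>X\<close> at its own unit
  eigenvector, and the form of \<open>Y\<close> at that same vector differs from it by at most
  \<open>entry_norm (X - Y)\<close>.\<close>

lemma spectrum_near_posdef:
  fixes Y :: "'n::finite op"
  assumes "posdef Y"
  obtains c C where "c > 0" "\<forall>X. cadj X = X \<longrightarrow> entry_norm (X - Y) \<le> c \<longrightarrow>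
     (\<exists>U x. unitary U \<and> X = udiag U x \<and> (\<forall>i. c \<le> x i \<and> x i \<le> C))"
proof -
  obtain c C where c: "c > 0" and b: "\<forall>x. norm x = 1 \<longrightarrow> c \<le> Re (qform Y x) \<and> Re (qform Y x) \<le> C"
    by (rule posdef_bounds[OF assms])
  \<comment> \<open>Half of the lower bound is given up to the perturbation, so that one constant
    serves both as the radius and as the new lower bound of the spectrum.\<close>
  have "\<exists>U x. unitary U \<and> X = udiag U x \<and> (\<forall>i. c / 2 \<le> x i \<and> x i \<le> C + c / 2)"
    if X: "cadj X = X" and n: "entry_norm (X - Y) \<le> c / 2" for X
  proof -
    obtain U x where U: "unitary U" and eq: "X = udiag U x" using hermitian_udiag[OF X] .
    have "c / 2 \<le> x i \<and> x i \<le> C + c / 2" for i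
    proof -
      let ?v = "column i U"
      have v: "norm ?v = 1" by (rule norm_column_unitary[OF U])
      have "\<bar>Re (qform (X - Y) ?v)\<bar> \<le> c / 2"
        using order_trans[OF abs_Re_le_cmod qform_bound[of "X - Y" ?v]] n by (simp add: v entry_norm_def)
      then have "\<bar>x i - Re (qform Y ?v)\<bar> \<le> c / 2"
        by (simp add: qform_diff eq qform_udiag_column[OF U])
      moreover have "c \<le> Re (qform Y ?v) \<and> Re (qform Y ?v) \<le> C" using b v by blast
      ultimately show ?thesis by linarith
    qed
    with U eq show ?thesis by blast
  qed
  with c that[of "c / 2" "C + c / 2"] show thesis by simp
qed

text \<open>The quantity estimated is the real part of the trace of \<open>X - Y\<close> times
  \<open>mpow X r - mat 1\<close>. In an eigenbasis of \<open>X\<close> the second factor is of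
  order \<open>r\<close>, uniformly because the spectrum stays in a fixed positive interval, and the
  first is at most \<open>entry_norm (X - Y)\<close>. The error is thus of second order when both
  shrink.\<close>

lemma mpow_near_posdef:
  fixes Y :: "'n::finite op"
  assumes "posdef Y"
  obtains c K where "c > 0" "K > 0" "\<forall>X r. cadj X = X \<longrightarrow> entry_norm (X - Y) \<le> c \<longrightarrow> K * \<bar>r\<bar> \<le> 1 \<longrightarrow>
     posdef X \<and> \<bar>Re (trace ((X - Y) ** mpow X r)) - Re (trace (X - Y))\<bar> \<le> K * \<bar>r\<bar> * entry_norm (X - Y)"
proof -
  obtain c C where c: "c > 0" and sp: "\<forall>X. cadj X = X \<longrightarrow> entry_norm (X - Y) \<le> c \<longrightarrow>
     (\<exists>U x. unitary U \<and> X = udiag U x \<and> (\<forall>i. c \<le> x i \<and> x i \<le> C))"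
    by (rule spectrum_near_posdef[OF assms])
  \<comment> \<open>Bounds the absolute value of \<open>ln\<close> between \<open>c\<close> and
    \<open>C\<close>; the added 1 keeps it positive.\<close>
  define B where "B = \<bar>ln c\<bar> + \<bar>ln C\<bar> + 1"
  have B: "B \<ge> 1" by (simp add: B_def)
  \<comment> \<open>The factor 2 comes from the scalar estimate and \<open>CARD('n)\<close> from the
    number of eigenvectors; \<open>K \<ge> B\<close> turns \<open>K * \<bar>r\<bar> \<le> 1\<close>
    into the smallness which that estimate requires.\<close>
  define K where "K = 2 * B * real CARD('n)"
  have "real CARD('n) \<ge> 1" by (simp add: Suc_leI)
  then have KB: "K \<ge> B" using B mult_mono[of 1 "real CARD('n)" B "2 * B"] by (simp add: K_def mult_ac)
  have "posdef X \<and> \<bar>Re (trace ((X - Y) ** mpow X r)) - Re (trace (X - Y))\<bar> \<le> K * \<bar>r\<bar> * entry_norm (X - Y)"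
    if X: "cadj X = X" and n: "entry_norm (X - Y) \<le> c" and r: "K * \<bar>r\<bar> \<le> 1" for X r
  proof -
    obtain U x where U: "unitary U" and eq: "X = udiag U x" and x: "\<And>i. c \<le> x i \<and> x i \<le> C"
      using sp X n by blast
    have xp: "\<forall>i. x i > 0" using x c by (meson less_le_trans)
    let ?D = "X - Y"
    have "\<bar>x i powr r - 1\<bar> \<le> 2 * B * \<bar>r\<bar>" for i
    proof (rule abs_powr_minus_one_le)
      have "ln c \<le> ln (x i)" "ln (x i) \<le> ln C" using x[of i] c xp by (auto simp: less_le_trans)
      then show "\<bar>ln (x i)\<bar> \<le> B" unfolding B_def by linarith
      show "\<bar>r\<bar> * B \<le> 1" using r mult_right_mono[OF KB, of "\<bar>r\<bar>"] by (simp add: mult.commute)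
    qed (use xp in blast)
    moreover have "cmod (qform ?D (column i U)) \<le> entry_norm ?D" for i
      using qform_bound[of ?D "column i U"] by (simp add: norm_column_unitary[OF U] entry_norm_def)
    ultimately have bnd: "cmod (complex_of_real (x i powr r - 1) * qform ?D (column i U)) \<le> 2 * B * \<bar>r\<bar> * entry_norm ?D" for i
      unfolding norm_mult norm_of_real by (intro mult_mono) (use B in auto)
    have "trace (?D ** mpow X r) - trace ?D = trace (?D ** udiag U (\<lambda>i. x i powr r)) - trace (?D ** udiag U (\<lambda>_. 1))"
      by (simp add: eq mpow_udiag[OF U xp] udiag_one[OF U])
    also have "\<dots> = (\<Sum>i\<in>UNIV. complex_of_real (x i powr r - 1) * qform ?D (column i U))"
      by (simp only: trace_mult_udiag sum_subtractf[symmetric]) (simp add: algebra_simps)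
    finally have "cmod (trace (?D ** mpow X r) - trace ?D) \<le> (\<Sum>i\<in>(UNIV::'n set). 2 * B * \<bar>r\<bar> * entry_norm ?D)"
      by (simp only:) (intro order_trans[OF norm_sum] sum_mono bnd)
    then have "\<bar>Re (trace (?D ** mpow X r) - trace ?D)\<bar> \<le> K * \<bar>r\<bar> * entry_norm ?D"
      using abs_Re_le_cmod[of "trace (?D ** mpow X r) - trace ?D"] by (simp add: K_def mult_ac)
    then show ?thesis using posdef_udiag[OF U xp] eq by simp
  qed
  with c KB B show thesis by (intro that[of c K]) auto
qed

section \<open>The lower bound and its slope\<close>

text \<open>The sum of two Young inequalities: the coefficients \<open>a\<close> and
  \<open>1 - a\<close> of the trace of \<open>mpow (X a) (1 / a)\<close> add up to one, and that
  trace merges with the trace of \<open>X 1 ** mpow (X a) (1 / a - 1)\<close> into the last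
  summand.\<close>

definition young_bound :: "(real \<Rightarrow> 'n::finite op) \<Rightarrow> real \<Rightarrow> real" where
  "young_bound X a = a * Re (trace (mpow (X 1) (1 / a))) + (1 - a)
     + Re (trace ((X a - X 1) ** mpow (X a) (1 / a - 1)))"

text \<open>The second use of \<open>trace_young\<close>, with \<open>X\<^sup>1\<^sup>/\<^sup>a\<close> as the second operator, replaces \<open>Tr X\<^sup>1\<^sup>/\<^sup>a\<close>, whose
  derivative in \<open>a\<close> is awkward, by a power of the fixed operator \<open>X 1\<close> plus a first-order correction.\<close>
lemma trace_mult_mpow_le_young_bound:
  assumes X: "posdef (X a)" and Y: "posdef (X 1)" and S: "posdef S" "trace S = 1" and a: "a > 0"
  shows "0 \<le> (1 - a) * (young_bound X a - Re (trace (X a ** mpow S (1 - a))))"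
proof -
  obtain U x where U: "unitary U" and Xe: "X a = udiag U x" and x: "\<forall>i. x i > 0"
    by (rule posdef_udiag_cases[OF X])
  let ?p = "1 / a"
  have xn: "x i \<noteq> 0" for i using x[rule_format, of i] by simp
  have pp: "mpow (mpow (X a) ?p) (1 - a) = mpow (X a) (?p - 1)"
  proof -
    have "?p * (1 - a) = ?p - 1" using a by (simp add: field_simps)
    then show ?thesis by (simp add: Xe mpow_udiag U x xn powr_powr)
  qed
  have "x i powr ?p = x i * x i powr (?p - 1)" for i
    using x[rule_format, of i] by (simp add: powr_mult_base)
  then have XX: "X a ** mpow (X a) (?p - 1) = mpow (X a) ?p"
    by (simp add: Xe mpow_udiag U x udiag_mult)
  let ?E = "a * Re (trace (mpow (X 1) ?p)) + (1 - a) * Re (trace (mpow (X a) ?p))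
            - Re (trace (X 1 ** mpow (X a) (?p - 1)))"
  let ?F = "a * Re (trace (mpow (X a) ?p)) + (1 - a) - Re (trace (X a ** mpow S (1 - a)))"
  have "0 \<le> (1 - a) * ?E"
    using trace_young[OF Y posdef_mpow[OF X, of ?p] a] by (simp add: pp)
  moreover have "0 \<le> (1 - a) * ?F"
    using trace_young[OF X S(1) a] by (simp add: S(2))
  moreover have "young_bound X a - Re (trace (X a ** mpow S (1 - a))) = ?E + ?F"
    by (simp add: young_bound_def bounded_bilinear.diff_left[OF bounded_bilinear_matrix_mult] trace_sub XX
        left_diff_distrib)
  ultimately show ?thesis by (simp only: distrib_left[of "1 - a" ?E ?F] add_nonneg_nonneg)
qed

text \<open>The last summand of \<open>young_bound\<close> is the trace of \<open>X a - X 1\<close>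
  up to a remainder without slope at 1. In the rest only the exponent of the fixed
  \<open>X 1\<close> moves, which gives the entropy term; the 1 from the product rule cancels
  against the derivative of \<open>1 - a\<close>.\<close>

lemma young_bound_deriv:
  fixes X :: "real \<Rightarrow> 'n::finite op"
  assumes X': "(X has_vector_derivative X') (at 1)" and h: "\<And>a. cadj (X a) = X a"
    and Y: "posdef (X 1)" and tr: "trace (X 1) = 1"
  shows "(young_bound X has_real_derivative Re (trace X') - Re (trace (X 1 ** mln (X 1)))) (at 1)"
    and "young_bound X 1 = 1" and "\<forall>\<^sub>F a in at 1. posdef (X a)"
proof -
  obtain c K where c: "c > 0" and K: "K > 0" and near: "\<forall>Z r. cadj Z = Z \<longrightarrow> entry_norm (Z - X 1) \<le> c \<longrightarrow> K * \<bar>r\<bar> \<le> 1 \<longrightarrow>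
     posdef Z \<and> \<bar>Re (trace ((Z - X 1) ** mpow Z r)) - Re (trace (Z - X 1))\<bar> \<le> K * \<bar>r\<bar> * entry_norm (Z - X 1)"
    by (rule mpow_near_posdef[OF Y])
  have "(X \<longlongrightarrow> X 1) (at 1)"
    using has_vector_derivative_continuous[OF X'] by (simp add: continuous_within)
  note en = tendsto_entry_norm[OF this]
  have e1: "\<forall>\<^sub>F a in at 1. entry_norm (X a - X 1) < c" by (rule order_tendstoD(2)[OF en c])
  \<comment> \<open>Exponent 0 satisfies the smallness condition on \<open>r\<close> trivially and
    yields positivity near 1.\<close>
  then show "\<forall>\<^sub>F a in at 1. posdef (X a)"
    by eventually_elim (use near[rule_format, of _ 0] h in auto)
  have "((\<lambda>a. K * \<bar>1 / a - 1\<bar>) \<longlongrightarrow> K * \<bar>1 / 1 - 1\<bar>) (at (1::real))" by (intro tendsto_intros) auto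
  then have e2: "\<forall>\<^sub>F a in at (1::real). K * \<bar>1 / a - 1\<bar> < 1" by (intro order_tendstoD(2)) auto
  have e3: "\<forall>\<^sub>F a in at (1::real). a > 0"
    by (rule order_tendstoD(1)[OF tendsto_ident_at]) simp
  define \<delta> where "\<delta> a = Re (trace ((X a - X 1) ** mpow (X a) (1 / a - 1))) - Re (trace (X a - X 1))" for a
  have d1: "\<delta> 1 = 0" by (simp add: \<delta>_def)
  have "((\<lambda>a. (\<delta> a - \<delta> 1) / (a - 1)) \<longlongrightarrow> 0) (at 1)"
  proof (rule Lim_null_comparison)
    have "((\<lambda>a. K * \<bar>1 / a\<bar> * entry_norm (X a - X 1)) \<longlongrightarrow> K * \<bar>1 / 1\<bar> * 0) (at 1)"
      by (intro tendsto_intros en) auto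
    then show "((\<lambda>a. K * \<bar>1 / a\<bar> * entry_norm (X a - X 1)) \<longlongrightarrow> 0) (at 1)" by simp
    have "\<forall>\<^sub>F a in at (1::real). a \<noteq> 1" by (simp add: eventually_at_filter)
    with e1 e2 e3 show "\<forall>\<^sub>F a in at 1. norm ((\<delta> a - \<delta> 1) / (a - 1)) \<le> K * \<bar>1 / a\<bar> * entry_norm (X a - X 1)"
    proof eventually_elim
      case (elim a)
      have "\<bar>\<delta> a\<bar> \<le> K * \<bar>1 / a - 1\<bar> * entry_norm (X a - X 1)"
        unfolding \<delta>_def using near h elim by auto
      \<comment> \<open>This factor cancels the denominator of the difference quotient;
        \<open>entry_norm (X a - X 1)\<close> is left and tends to 0.\<close>
      moreover have "\<bar>1 / a - 1\<bar> = \<bar>1 / a\<bar> * \<bar>a - 1\<bar>"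
        using elim by (simp add: abs_mult[symmetric] field_simps abs_minus_commute)
      ultimately have "\<bar>\<delta> a\<bar> \<le> K * \<bar>1 / a\<bar> * entry_norm (X a - X 1) * \<bar>a - 1\<bar>" by (simp add: mult_ac)
      then show ?case using elim by (simp add: d1 divide_le_eq)
    qed
  qed
  then have \<delta>': "(\<delta> has_real_derivative 0) (at 1)" by (simp add: has_field_derivative_iff)
  have inv: "((\<lambda>a. 1 / a) has_real_derivative -1) (at (1::real))"
    by (auto intro!: derivative_eq_intros)
  have q: "((\<lambda>a. Re (trace (mpow (X 1) (1 / a)))) has_real_derivative - Re (trace (X 1 ** mln (X 1)))) (at 1)"
    unfolding has_real_derivative_iff_has_vector_derivative
    using bounded_linear.has_vector_derivative[OF bounded_linear_op(1) mpow_has_vector_derivative[OF Y inv]]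
    by (simp add: mpow_1[OF Y] bounded_linear.linear[OF bounded_linear_op(1), THEN linear_neg])
  have s: "((\<lambda>a. Re (trace (X a - X 1))) has_real_derivative Re (trace X')) (at 1)"
    unfolding has_real_derivative_iff_has_vector_derivative trace_sub minus_complex.sel
    using has_vector_derivative_diff[OF bounded_linear.has_vector_derivative[OF bounded_linear_op(1) X'] has_vector_derivative_const]
    by simp
  have "young_bound X = (\<lambda>a. a * Re (trace (mpow (X 1) (1 / a))) + (1 - a) + (Re (trace (X a - X 1)) + \<delta> a))"
    by (simp add: fun_eq_iff young_bound_def \<delta>_def)
  then show "(young_bound X has_real_derivative Re (trace X') - Re (trace (X 1 ** mln (X 1)))) (at 1)"
    using DERIV_add[OF DERIV_add[OF DERIV_mult[OF DERIV_ident q] DERIV_diff[OF DERIV_const DERIV_ident]]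
        DERIV_add[OF s \<delta>']]
    by (simp add: mpow_1[OF Y] tr)
  show "young_bound X 1 = 1" using trace_sub[of "X 1" "X 1"] by (simp add: young_bound_def mpow_1[OF Y] tr)
qed

text \<open>Since \<open>ln (f 1) = 0\<close>, the expression is the difference quotient of
  \<open>ln (f a)\<close> at 1, and the logarithmic derivative there is
  \<open>d / f 1 = d\<close>.\<close>

lemma tendsto_ln_slope:
  fixes f :: "real \<Rightarrow> real"
  assumes f: "(f has_real_derivative d) (at 1)" and "f 1 = 1"
  shows "((\<lambda>a. 1 / (a - 1) * ln (f a)) \<longlongrightarrow> d) (at 1)"
proof -
  have "((\<lambda>a. ln (f a)) has_real_derivative d) (at 1)"
    using assms(2) by (auto intro!: derivative_eq_intros f)
  then show ?thesis using assms(2) by (simp add: has_field_derivative_iff)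
qed

section \<open>The operator on BC and its derivative\<close>

definition renyi_op :: "('a::finite \<times> 'b::finite \<times> 'c::finite) op \<Rightarrow> real \<Rightarrow> ('b \<times> 'c) op" where
  "renyi_op \<rho> \<alpha> = marg_BC (ext_C (mpow (marg_C \<rho>) ((\<alpha> - 1) / 2)) ** (ext_AC (mpow (marg_AC \<rho>) ((1 - \<alpha>) / 2))
     ** mpow \<rho> \<alpha> ** ext_AC (mpow (marg_AC \<rho>) ((1 - \<alpha>) / 2))) ** ext_C (mpow (marg_C \<rho>) ((\<alpha> - 1) / 2)))"

lemma renyi_cmi_renyi_op:
  fixes \<rho> :: "('a::finite \<times> 'b::finite \<times> 'c::finite) op"
  assumes "posdef \<rho>"
  shows "renyi_cmi \<alpha> \<rho> = (INF \<sigma> \<in> {\<sigma>. posdef \<sigma> \<and> trace \<sigma> = 1}.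
           1 / (\<alpha> - 1) * ln (Re (trace (renyi_op \<rho> \<alpha> ** mpow \<sigma> (1 - \<alpha>)))))"
proof -
  have "trace (P ** A ** C ** B ** C ** A) = trace (C ** (A ** P ** A) ** C ** B)"
    for P A B C :: "('a \<times> 'b \<times> 'c) op"
    using trace_mul_sym[of "P ** A ** C ** B" "C ** A"] by (simp add: matrix_mul_assoc)
  then show ?thesis
    by (simp only: renyi_cmi_def admissible_states[OF assms] renyi_op_def trace_marg_BC)
qed

lemma renyi_op_1: "posdef \<rho> \<Longrightarrow> renyi_op \<rho> 1 = marg_BC \<rho>"
  by (simp add: renyi_op_def mpow_0 mpow_1 posdef_marg_AC posdef_marg_C)

text \<open>The factors stand symmetrically around \<open>mpow \<rho> \<alpha>\<close>. Hermiticity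
  and continuity then give positivity near \<alpha> = 1 through the eigenvalue perturbation
  bound.\<close>

lemma cadj_renyi_op: "posdef \<rho> \<Longrightarrow> cadj (renyi_op \<rho> \<alpha>) = renyi_op \<rho> \<alpha>"
  by (simp add: renyi_op_def cadj_marg_BC cadj_mult cadj_ext cadj_mpow posdef_marg_AC posdef_marg_C matrix_mul_assoc)

text \<open>At \<alpha> = 1 the powers of the marginals are identities, so each Leibniz term has a
  single logarithm beside \<rho>. Under the trace the two copies of each outer factor agree by
  cyclicity, their slopes -1/2 and 1/2 double to -1 and 1, and duality with the marginals turns the
  terms into entropies.\<close>

lemma renyi_op_deriv:
  fixes \<rho> :: "('a::finite \<times> 'b::finite \<times> 'c::finite) op"
  assumes \<rho>: "posdef \<rho>"
  obtains X' where "(renyi_op \<rho> has_vector_derivative X') (at 1)"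
    "Re (trace X') = vN (marg_AC \<rho>) - vN (marg_C \<rho>) - vN \<rho>"
proof -
  note pd = \<rho> posdef_marg_AC[OF \<rho>] posdef_marg_C[OF \<rho>]
  interpret m: bounded_bilinear "\<lambda>A B. (A :: ('a \<times> 'b \<times> 'c) op) ** (B :: ('a \<times> 'b \<times> 'c) op)" by (rule bounded_bilinear_matrix_mult)
  let ?a = "(- 1 / 2) *\<^sub>R mln (marg_AC \<rho>)" and ?c = "(1 / 2) *\<^sub>R mln (marg_C \<rho>)"
  let ?A = "ext_AC ?a :: ('a \<times> 'b \<times> 'c) op" and ?C = "ext_C ?c :: ('a \<times> 'b \<times> 'c) op"
  have d2: "((\<lambda>\<alpha>::real. (1 - \<alpha>) / 2) has_real_derivative - 1 / 2) (at 1)"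
    and d3: "((\<lambda>\<alpha>::real. (\<alpha> - 1) / 2) has_real_derivative 1 / 2) (at 1)"
    by (auto intro!: derivative_eq_intros)
  have "((\<lambda>\<alpha>. mpow (marg_AC \<rho>) ((1 - \<alpha>) / 2)) has_vector_derivative ?a) (at 1)"
    using mpow_has_vector_derivative[OF pd(2) d2] by (simp add: mpow_0[OF pd(2)])
  note A = bounded_linear.has_vector_derivative[OF bounded_linear_op(3) this]
  have "((\<lambda>\<alpha>. mpow (marg_C \<rho>) ((\<alpha> - 1) / 2)) has_vector_derivative ?c) (at 1)"
    using mpow_has_vector_derivative[OF pd(3) d3] by (simp add: mpow_0[OF pd(3)])
  note C = bounded_linear.has_vector_derivative[OF bounded_linear_op(4) this]
  have P: "((\<lambda>\<alpha>. mpow \<rho> \<alpha>) has_vector_derivative \<rho> ** mln \<rho>) (at 1)"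
    using mpow_has_vector_derivative[OF pd(1) DERIV_ident, of 1] by (simp add: mpow_1[OF \<rho>])
  note D = m.has_vector_derivative[OF m.has_vector_derivative[OF C m.has_vector_derivative[OF m.has_vector_derivative[OF A P] A]] C]
  note D' = bounded_linear.has_vector_derivative[OF bounded_linear_op(2) D]
  show thesis
  proof (rule that)
    show "(renyi_op \<rho> has_vector_derivative marg_BC (\<rho> ** ?C + (\<rho> ** ?A + (\<rho> ** mln \<rho> + ?A ** \<rho>) + ?C ** \<rho>))) (at 1)"
      using D' by (simp add: renyi_op_def[abs_def] mpow_0 mpow_1 pd)
    have vN: "vN M = - Re (trace (M ** mln M))" for M :: "'n::finite op"
      by (simp add: vN_def mln_def)
    have sc: "Re (trace (r *\<^sub>R M)) = r * Re (trace M)" for r and M :: "'n::finite op"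
      by (simp add: trace_def scaleR_sum_right[symmetric] sum_distrib_left)
    have "Re (trace (marg_BC (\<rho> ** ?C + (\<rho> ** ?A + (\<rho> ** mln \<rho> + ?A ** \<rho>) + ?C ** \<rho>))))
       = 2 * Re (trace (\<rho> ** ?C)) + 2 * Re (trace (\<rho> ** ?A)) + Re (trace (\<rho> ** mln \<rho>))"
      by (simp only: trace_marg_BC_eq trace_add plus_complex.sel trace_mul_sym[of ?C \<rho>] trace_mul_sym[of ?A \<rho>])
    also have "\<dots> = vN (marg_AC \<rho>) - vN (marg_C \<rho>) - vN \<rho>"
      by (simp only: trace_marg_AC trace_marg_C matrix_scaleR sc vN)
    finally show "Re (trace (marg_BC (\<rho> ** ?C + (\<rho> ** ?A + (\<rho> ** mln \<rho> + ?A ** \<rho>) + ?C ** \<rho>))))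
       = vN (marg_AC \<rho>) - vN (marg_C \<rho>) - vN \<rho>" .
  qed
qed

theorem mainTheorem8:
  fixes \<rho> :: "('a::finite \<times> 'b::finite \<times> 'c::finite) op"
  assumes "density_op \<rho>" and "posdef \<rho>"
  shows "((\<lambda>\<alpha>. renyi_cmi \<alpha> \<rho>) \<longlongrightarrow> cmi \<rho>) (at 1)"
proof -
  let ?X = "renyi_op \<rho>" and ?Y = "marg_BC \<rho>"
  let ?S = "{\<sigma> :: ('b \<times> 'c) op. posdef \<sigma> \<and> trace \<sigma> = 1}"
  let ?Q = "\<lambda>\<alpha> \<sigma>. Re (trace (?X \<alpha> ** mpow \<sigma> (1 - \<alpha>)))"
  let ?L = "\<lambda>\<alpha>. 1 / (\<alpha> - 1) * ln (young_bound ?X \<alpha>)" and ?U = "\<lambda>\<alpha>. 1 / (\<alpha> - 1) * ln (?Q \<alpha> ?Y)"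
  have Y: "posdef ?Y" "trace ?Y = 1"
    using assms by (simp_all add: posdef_marg_BC trace_marg_BC_eq density_op_def)
  note X1 = renyi_op_1[OF assms(2)]
  obtain X' where X': "(?X has_vector_derivative X') (at 1)"
    and trX': "Re (trace X') = vN (marg_AC \<rho>) - vN (marg_C \<rho>) - vN \<rho>"
    by (rule renyi_op_deriv[OF assms(2)])
  have vNY: "vN ?Y = - Re (trace (?Y ** mln ?Y))" by (simp add: vN_def mln_def)
  have cmi: "cmi \<rho> = Re (trace X') - Re (trace (?Y ** mln ?Y))"
    by (simp add: cmi_def trX' vNY)
  note R = young_bound_deriv[OF X' cadj_renyi_op[OF assms(2)], unfolded X1, OF Y]
  have L: "(?L \<longlongrightarrow> cmi \<rho>) (at 1)"
    unfolding cmi by (rule tendsto_ln_slope[OF R(1,2)])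
  have U: "(?U \<longlongrightarrow> cmi \<rho>) (at 1)"
  proof (rule tendsto_ln_slope)
    interpret m: bounded_bilinear "\<lambda>A B. (A :: ('b \<times> 'c) op) ** (B :: ('b \<times> 'c) op)" by (rule bounded_bilinear_matrix_mult)
    have "((\<lambda>\<alpha>::real. 1 - \<alpha>) has_real_derivative -1) (at 1)" by (auto intro!: derivative_eq_intros)
    \<comment> \<open>The slope of this power supplies the entropy of BC, the one absent from
      \<open>trX'\<close>.\<close>
    from mpow_has_vector_derivative[OF Y(1) this]
    have "((\<lambda>\<alpha>. mpow ?Y (1 - \<alpha>)) has_vector_derivative - mln ?Y) (at 1)" by (simp add: mpow_0[OF Y(1)])
    from bounded_linear.has_vector_derivative[OF bounded_linear_op(1) m.has_vector_derivative[OF X' this]]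
    show "((\<lambda>\<alpha>. ?Q \<alpha> ?Y) has_real_derivative cmi \<rho>) (at 1)"
      by (simp add: has_real_derivative_iff_has_vector_derivative X1 mpow_0[OF Y(1)] cmi trace_add
          m.minus_right trace_sub m.diff_right)
    show "?Q 1 ?Y = 1" by (simp add: X1 mpow_0 Y)
  qed
  have "young_bound ?X \<midarrow>1\<rightarrow> 1"
    using DERIV_isCont[OF R(1)] R(2) by (simp add: isCont_def)
  then have "\<forall>\<^sub>F \<alpha> in at 1. young_bound ?X \<alpha> > 0" by (rule order_tendstoD(1)) simp
  moreover have "\<forall>\<^sub>F \<alpha> in at (1::real). \<alpha> > 0" by (rule order_tendstoD(1)[OF tendsto_ident_at]) simp
  moreover have "\<forall>\<^sub>F \<alpha> in at (1::real). \<alpha> \<noteq> 1" by (simp add: eventually_at_filter)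
  ultimately have "\<forall>\<^sub>F \<alpha> in at 1. ?L \<alpha> \<le> renyi_cmi \<alpha> \<rho> \<and> renyi_cmi \<alpha> \<rho> \<le> ?U \<alpha>"
    using R(3)
  proof eventually_elim
    case (elim \<alpha>)
    \<comment> \<open>For \<alpha> < 1 the trace is at most \<open>young_bound\<close> and the
      prefactor is negative; for \<alpha> > 1 both signs are reversed. Either way a lower bound
      results.\<close>
    have lb: "?L \<alpha> \<le> 1 / (\<alpha> - 1) * ln (?Q \<alpha> \<sigma>)" if "\<sigma> \<in> ?S" for \<sigma>
    proof -
      have T: "?Q \<alpha> \<sigma> > 0" using that elim by (intro trace_mult_mpow_pos) auto
      have *: "0 \<le> (1 - \<alpha>) * (young_bound ?X \<alpha> - ?Q \<alpha> \<sigma>)"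
        using that elim Y(1) by (intro trace_mult_mpow_le_young_bound) (auto simp: X1)
      show ?thesis
      proof (cases "\<alpha> < 1")
        case True
        then have "ln (?Q \<alpha> \<sigma>) \<le> ln (young_bound ?X \<alpha>)"
          using * T elim by (simp add: zero_le_mult_iff)
        then show ?thesis using True by (intro mult_left_mono_neg) auto
      next
        case False
        then have "ln (young_bound ?X \<alpha>) \<le> ln (?Q \<alpha> \<sigma>)"
          using * T elim by (simp add: zero_le_mult_iff)
        then show ?thesis using False by (intro mult_left_mono) auto
      qed
    qed
    \<comment> \<open>The infimum of reals is informative only over a nonempty set that is bounded
      below; \<open>YS\<close> and \<open>lb\<close> provide both.\<close>
    have YS: "?Y \<in> ?S" using Y by simp
    have "bdd_below ((\<lambda>\<sigma>. 1 / (\<alpha> - 1) * ln (?Q \<alpha> \<sigma>)) ` ?S)"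
      using lb by (auto intro!: bdd_belowI2)
    then show ?case
      unfolding renyi_cmi_renyi_op[OF assms(2)] using lb YS
      by (intro conjI cINF_greatest cINF_lower) auto
  qed
  then show ?thesis
    by (intro tendsto_sandwich[OF _ _ L U]) (auto elim: eventually_mono)
qed

end
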